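(* Let $f:\mathbb{R}_{>0}\to\mathbb{R}$ be continuous and non-decreasing with $f(t)<1$ for all $t$. Then the set $\{\alpha\in\mathbb{R}: u_\alpha\mathbb{Z}^2\in T(f)\}$ has full Lebesgue measure if $\int(1-f(t))\,dt$ diverges and Lebesgue measure zero if it converges.
   Context: $u_\alpha=\begin{pmatrix}1&\alpha\\0&1\end{pmatrix}$; $X$ is the space of unimodular lattices in $\mathbb{R}^2$; $a_t=\operatorname{diag}(e^t,e^{-t})$; $\Delta=\sqrt3/2$; $\mathcal{K}(r)=\{\Lambda\in X:\Lambda$ has no nonzero vector of Euclidean norm $<r/\sqrt\Delta\}$; $T(f)=\{\Lambda\in X:a_t\Lambda\in\mathcal{K}(f(t))$ for an unbounded set of $t>0\}$. *)

theory Defs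
  imports "HOL-Analysis.Analysis"
begin

definition u_mat :: "real \<Rightarrow> real^2^2" where
  "u_mat \<alpha> = vector [vector [1, \<alpha>], vector [0, 1]]"

definition a_mat :: "real \<Rightarrow> real^2^2" where
  "a_mat t = vector [vector [exp t, 0], vector [0, exp (- t)]]"

definition int_lattice :: "(real^2) set" where
  "int_lattice = {v. \<forall>i. v $ i \<in> \<int>}"

definition mat_act :: "real^2^2 \<Rightarrow> (real^2) set \<Rightarrow> (real^2) set" where
  "mat_act g L = (\<lambda>v. g *v v) ` L"

text \<open>A lattice is given by a basis, the columns of \<open>g\<close>; its covolume is \<open>\<bar>det g\<bar>\<close>.\<close>

definition unimodular_lattices :: "(real^2) set set" where
  "unimodular_lattices = {mat_act g int_lattice | g. \<bar>det g\<bar> = 1}"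

definition Delta :: real where
  "Delta = sqrt 3 / 2"

definition K_set :: "real \<Rightarrow> (real^2) set set" where
  "K_set r = {L \<in> unimodular_lattices. \<not> (\<exists>v\<in>L. v \<noteq> 0 \<and> norm v < r / sqrt Delta)}"

text \<open>Only the values of \<open>f\<close> on the positive reals matter.\<close>

definition T_set :: "(real \<Rightarrow> real) \<Rightarrow> (real^2) set set" where
  "T_set f = {L \<in> unimodular_lattices.
     \<not> bounded {t. t > 0 \<and> mat_act (a_mat t) L \<in> K_set (f t)}}"

end

theory Submission
  imports Defs
begin

text \<open>
  With \<open>\<epsilon> = 1 - f t\<close>, the lattice \<open>a\<^sub>t u\<^sub>\<alpha> \<int>\<^sup>2\<close> lies in \<open>K (f t)\<close> essentially when \<open>- \<alpha>\<close> is within \<open>O(\<epsilon> y)\<close> of the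
  real part of a point of the modular orbit of the hexagonal point whose height \<open>y\<close> is comparable
  to \<open>exp (- 2 t)\<close>: in one direction by perturbing the hexagonal form, in the other because a reduced
  form with nearly maximal minimum has all its coefficients close to those of the hexagonal form.
  About \<open>1 / y\<close> orbit points per unit length have height comparable to \<open>y\<close>, so each unit of time
  contributes a set of measure comparable to \<open>\<epsilon>\<close>. Convergence is then the Borel--Cantelli lemma. For
  divergence, Dirichlet's theorem provides well separated orbit points at every scale in every interval;
  separation makes the sets quasi-independent, the Chung--Erdos inequality shows that the limsup set
  fills a fixed proportion of every interval, and a set with this property has null complement.
\<close>

text \<open>The number \<open>1 / Delta\<close> is the largest squared minimum of a unimodular
  lattice and is attained only by hexagonal lattices, so for \<open>r\<close> near 1 the set
  \<open>K_set r\<close> is a small neighbourhood of these. Its hyperbolic radius is linear in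
  \<epsilon>. A disc of that radius has area of order \<epsilon>^2, but a geodesic that meets it
  typically stays for a time of order \<epsilon>; so unit time contributes order \<epsilon>, which
  is why the integral of \<open>1 - f\<close> itself decides.

  Divergence is organised by powers of 4 instead of time: level \<open>k\<close> belongs to times
  near \<open>k * ln 2\<close>. The change of scale is harmless because \<open>f\<close> is
  non-decreasing, so that level \<open>k\<close> can be compared with \<open>f (k + 1)\<close>.

  Real parts of orbit points of comparable but different heights can be close together. Both the
  lower bound for one level and the overlap bound for two levels need separated centres; hence the
  selection of a separated subset, which must be shown to remain large.\<close>

section \<open>The lattice as a binary quadratic form\<close>

definition lattice_form :: "real \<Rightarrow> real \<Rightarrow> int \<Rightarrow> int \<Rightarrow> real" where
  "lattice_form \<alpha> t p q = (exp t * (p + \<alpha> * q))\<^sup>2 + (exp (- t) * q)\<^sup>2"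

lemma norm_vec2: "norm (v :: real^2) = sqrt ((v $ 1)\<^sup>2 + (v $ 2)\<^sup>2)"
  by (simp add: norm_vec_def L2_set_def sum_2)

lemma u_mat_mult: "(u_mat \<alpha> *v v) = vector [v $ 1 + \<alpha> * v $ 2, v $ 2]"
  by (simp add: vec_eq_iff forall_2 u_mat_def matrix_vector_mult_def sum_2)

lemma a_mat_mult: "(a_mat t *v v) = vector [exp t * v $ 1, exp (- t) * v $ 2]"
  by (simp add: vec_eq_iff forall_2 a_mat_def matrix_vector_mult_def sum_2)

lemma mat_act_mat_act: "mat_act g (mat_act h L) = mat_act (g ** h) L"
  by (auto simp: mat_act_def image_image matrix_vector_mul_assoc)

lemma det_u_mat: "det (u_mat \<alpha>) = 1"
  by (simp add: det_2 u_mat_def)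

lemma det_a_mat: "det (a_mat t) = 1"
  by (simp add: det_2 a_mat_def flip: exp_add)

lemma int_lattice_altdef: "int_lattice = {vector [of_int p, of_int q] | p q. True}"
proof (intro equalityI subsetI)
  fix v assume "v \<in> int_lattice"
  then obtain p q where "v $ 1 = of_int p" "v $ 2 = of_int q"
    by (auto simp: int_lattice_def forall_2 elim!: Ints_cases)
  then have "v = vector [of_int p, of_int q]"
    by (simp add: vec_eq_iff forall_2)
  then show "v \<in> {vector [of_int p, of_int q] | p q. True}" by blast
qed (auto simp: int_lattice_def forall_2)

lemma norm_flow_vector:
  "norm (a_mat t *v (u_mat \<alpha> *v vector [of_int p, of_int q])) = sqrt (lattice_form \<alpha> t p q)"
  by (simp add: norm_vec2 u_mat_mult a_mat_mult lattice_form_def)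

lemma lattice_form_eq_0_iff: "lattice_form \<alpha> t p q = 0 \<longleftrightarrow> p = 0 \<and> q = 0"
  by (auto simp: lattice_form_def sum_power2_eq_zero_iff)

text \<open>The inequality stays unsquared because \<open>f t\<close> may be negative: the condition
  then holds trivially, and squaring would change it.\<close>

lemma lattice_in_T_set_iff:
  "mat_act (u_mat \<alpha>) int_lattice \<in> T_set f \<longleftrightarrow>
    \<not> bounded {t. t > 0 \<and> (\<forall>p q. (p, q) \<noteq> (0, 0) \<longrightarrow> f t / sqrt Delta \<le> sqrt (lattice_form \<alpha> t p q))}"
proof -
  have uni: "mat_act g int_lattice \<in> unimodular_lattices" if "det g = 1" for g
    using that by (auto simp: unimodular_lattices_def)
  have "mat_act (a_mat t) (mat_act (u_mat \<alpha>) int_lattice) \<in> K_set r \<longleftrightarrow>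
      (\<forall>p q. (p, q) \<noteq> (0, 0) \<longrightarrow> r / sqrt Delta \<le> sqrt (lattice_form \<alpha> t p q))" for t r
  proof -
    let ?w = "\<lambda>p q. a_mat t *v (u_mat \<alpha> *v vector [of_int p, of_int q])"
    have "mat_act (a_mat t) (mat_act (u_mat \<alpha>) int_lattice) \<in> unimodular_lattices"
      unfolding mat_act_mat_act by (rule uni) (simp add: det_mul det_a_mat det_u_mat)
    moreover have "?w p q \<noteq> 0 \<longleftrightarrow> (p, q) \<noteq> (0, 0)" for p q
    proof -
      have "?w p q = 0 \<longleftrightarrow> norm (?w p q) = 0" by simp
      also have "\<dots> \<longleftrightarrow> lattice_form \<alpha> t p q = 0" by (simp only: norm_flow_vector real_sqrt_eq_0_iff)
      finally show ?thesis by (simp add: lattice_form_eq_0_iff)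
    qed
    moreover have "(\<exists>v\<in>mat_act (a_mat t) (mat_act (u_mat \<alpha>) int_lattice). v \<noteq> 0 \<and> norm v < R) \<longleftrightarrow>
        (\<exists>p q. ?w p q \<noteq> 0 \<and> norm (?w p q) < R)" for R
      unfolding mat_act_def int_lattice_altdef by blast
    ultimately show ?thesis
      unfolding K_set_def mem_Collect_eq norm_flow_vector by (meson not_less)
  qed
  then show ?thesis
    by (simp add: T_set_def uni det_u_mat)
qed

text \<open>
  The equation \<open>4 N c = b\<^sup>2 + 3\<close> says that \<open>(- b + i \<surd>3) / (2 N)\<close> lies in the modular orbit of the
  hexagonal point; \<open>t\<close> is the time at which the vertical geodesic above it passes its height.
\<close>

lemma lattice_form_near_hexagonal:
  fixes N b c p q :: int
  assumes N: "N > 0" and disc: "4 * N * c = b\<^sup>2 + 3" and t: "t = ln (2 * N / sqrt 3) / 2"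
    and near: "\<bar>\<alpha> - b / (2 * N)\<bar> \<le> (1 - r) * (sqrt 3 / (2 * N))"
    and r: "r < 1" and pq: "(p, q) \<noteq> (0, 0)"
  shows "r / sqrt Delta \<le> sqrt (lattice_form \<alpha> t p q)"
proof (cases "r \<le> 0")
  case True
  then have "r / sqrt Delta \<le> 0" by (simp add: divide_nonpos_nonneg Delta_def)
  also have "0 \<le> sqrt (lattice_form \<alpha> t p q)" by (simp add: lattice_form_def)
  finally show ?thesis .
next
  case False
  \<comment> \<open>In the upper half-plane the lattice is the point with real part
    \<open>\<alpha>\<close> and height \<open>y = exp (- 2 * t)\<close>. It has the height of the
    hexagonal point, and \<open>\<eta>\<close> is the horizontal offset between the two in units of
    that height.\<close>
  define y where "y = sqrt 3 / (2 * N)"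
  define s where "s = p + b / (2 * N) * q"
  define \<eta> where "\<eta> = (\<alpha> - b / (2 * N)) / y"
  have y: "y > 0" using N by (simp add: y_def)
  have \<alpha>: "\<alpha> = b / (2 * N) + \<eta> * y" using y by (simp add: \<eta>_def)
  have "\<bar>\<eta>\<bar> * y = \<bar>\<alpha> - b / (2 * N)\<bar>" using y by (simp add: \<eta>_def abs_divide)
  then have "\<bar>\<eta>\<bar> * y \<le> (1 - r) * y" using near by (simp add: y_def)
  then have \<eta>: "\<bar>\<eta>\<bar> \<le> 1 - r" using y by (simp only: mult_le_cancel_right_pos)
  have e2: "exp t ^ 2 = 1 / y"
    using N by (simp add: t y_def exp_double[symmetric])
  have em2: "exp (- t) ^ 2 = y"
    using e2 y by (simp add: exp_minus power_inverse)
  have ND: "N / Delta = 1 / y" by (simp add: y_def Delta_def)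
  \<comment> \<open>The discriminant equation makes the hexagonal form integral; being positive off
    the origin, it is at least 1 there.\<close>
  have int_form: "N * (s\<^sup>2 + (q * y)\<^sup>2) = of_int (N * p\<^sup>2 + b * p * q + c * q\<^sup>2)"
  proof -
    have "real_of_int b * real_of_int b + 3 = 4 * N * c" 
      using disc by (metis of_int_add of_int_mult of_int_numeral power2_eq_square)
    then have c: "real_of_int c = (real_of_int b * real_of_int b + 3) / (4 * N)" using N by simp
    have y2: "y * y = 3 / (4 * N * N)" by (simp add: y_def)
    have "N * (s\<^sup>2 + (q * y)\<^sup>2) = N * s * s + N * q * q * (y * y)"
      by (simp add: power2_eq_square algebra_simps)
    also have "\<dots> = of_int (N * p\<^sup>2 + b * p * q + c * q\<^sup>2)"
      using N by (simp add: s_def c y2 power2_eq_square field_simps)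
    finally show ?thesis .
  qed
  have "s\<^sup>2 + (q * y)\<^sup>2 > 0"
    using pq y by (auto simp: s_def sum_power2_gt_zero_iff)
  then have "real_of_int (N * p\<^sup>2 + b * p * q + c * q\<^sup>2) > 0"
    unfolding int_form[symmetric] using N by simp
  then have "N * p\<^sup>2 + b * p * q + c * q\<^sup>2 \<ge> 1"
    unfolding of_int_0_less_iff by linarith
  then have ge1: "N * (s\<^sup>2 + (q * y)\<^sup>2) \<ge> 1"
    unfolding int_form of_int_1_le_iff .
  \<comment> \<open>The cross term never exceeds the form, so an offset \<open>\<eta>\<close> costs
    at most a factor \<open>1 - \<bar>\<eta>\<bar>\<close>; the square of the shift only
    helps.\<close>
  have "\<bar>2 * s * (q * y)\<bar> \<le> s\<^sup>2 + (q * y)\<^sup>2"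
    using zero_le_power2[of "s - q * y"] zero_le_power2[of "s + q * y"]
    by (simp add: power2_eq_square algebra_simps abs_le_iff)
  then have "\<bar>\<eta>\<bar> * \<bar>2 * s * (q * y)\<bar> \<le> \<bar>\<eta>\<bar> * (s\<^sup>2 + (q * y)\<^sup>2)"
    by (intro mult_left_mono) auto
  then have "2 * s * (\<eta> * q * y) \<ge> - \<bar>\<eta>\<bar> * (s\<^sup>2 + (q * y)\<^sup>2)"
    using abs_ge_minus_self[of "\<eta> * (2 * s * (q * y))"] by (simp add: abs_mult mult_ac)
  then have "(s + \<eta> * q * y)\<^sup>2 + (q * y)\<^sup>2 \<ge> (1 - \<bar>\<eta>\<bar>) * (s\<^sup>2 + (q * y)\<^sup>2)"
    unfolding power2_sum[of s] left_diff_distrib mult_minus_left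
    using zero_le_power2[of "\<eta> * q * y"] by argo
  moreover have "(1 - \<bar>\<eta>\<bar>) * (s\<^sup>2 + (q * y)\<^sup>2) \<ge> r * (s\<^sup>2 + (q * y)\<^sup>2)"
    using \<eta> by (intro mult_right_mono) auto
  moreover have "lattice_form \<alpha> t p q = ((s + \<eta> * q * y)\<^sup>2 + (q * y)\<^sup>2) / y"
  proof -
    have "lattice_form \<alpha> t p q = (1 / y) * (p + \<alpha> * q)\<^sup>2 + y * q\<^sup>2"
      by (simp add: lattice_form_def power_mult_distrib e2 em2)
    moreover have "p + \<alpha> * q = s + \<eta> * q * y"
      by (simp add: s_def \<alpha> algebra_simps)
    ultimately show ?thesis using y by (simp add: field_simps power2_eq_square)
  qed
  ultimately have "lattice_form \<alpha> t p q \<ge> r * (s\<^sup>2 + (q * y)\<^sup>2) / y"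
    using y by (simp add: divide_right_mono)
  also have "r * (s\<^sup>2 + (q * y)\<^sup>2) / y = r * (N * (s\<^sup>2 + (q * y)\<^sup>2)) / Delta"
    using ND by (metis (no_types, opaque_lifting) mult.assoc mult.commute mult.left_neutral times_divide_eq_left)
  finally have lf: "lattice_form \<alpha> t p q \<ge> r * (N * (s\<^sup>2 + (q * y)\<^sup>2)) / Delta" .
  \<comment> \<open>The estimate so far gives \<open>r / Delta\<close>; only the smaller
    \<open>r\<^sup>2 / Delta\<close> is wanted.\<close>
  have "r\<^sup>2 \<le> r * (N * (s\<^sup>2 + (q * y)\<^sup>2))"
    unfolding power2_eq_square[of r] using False r ge1 by (intro mult_left_mono) auto
  then have "r\<^sup>2 / Delta \<le> lattice_form \<alpha> t p q"
    using lf by (smt (verit) Delta_def divide_right_mono real_sqrt_ge_zero zero_le_divide_iff)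
  then show ?thesis
    using False by (intro real_le_rsqrt) (simp add: power_divide Delta_def)
qed

section \<open>Hexagonal points near a given number\<close>

text \<open>The form \<open>x\<^sup>2 + x * y + y\<^sup>2\<close> evaluated at
  \<open>(q * X + p * Y, s * X + r * Y)\<close> has coefficients \<open>N\<close>, \<open>b\<close>,
  \<open>c\<close>. The substitution has determinant -1 and so keeps the discriminant -3. A small
  \<open>s\<close> keeps \<open>N\<close> comparable to \<open>q\<^sup>2\<close>, and the distance
  from \<open>b / (2 * N)\<close> to \<open>p / q\<close> is exactly
  \<open>(q + 2 * s) / (2 * N * q)\<close>.\<close>

lemma hexagonal_near_rational:
  fixes p q :: int
  assumes "coprime p q" "q > 0"
  obtains N b c :: int where "4 * N * c = b\<^sup>2 + 3" "q\<^sup>2 \<le> N" "N \<le> 3 * q\<^sup>2"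
    "\<bar>b / (2 * N) - p / q\<bar> \<le> 3 / (2 * q\<^sup>2)"
proof -
  obtain u v where "u * p + v * q = 1"
    using bezout_int[of p q] assms by auto
  \<comment> \<open>Only the class of the Bezout coefficient modulo \<open>q\<close> matters; the
    reduced one gives \<open>s < q\<close> and hence \<open>N \<le> 3 * q\<^sup>2\<close>.\<close>
  define s where "s = u mod q"
  have s: "0 \<le> s" "s < q" using assms by (simp_all add: s_def)
  have "(p * s) mod q = 1 mod q"
  proof -
    have "p * u = 1 + (- v) * q" using \<open>u * p + v * q = 1\<close> by (simp add: algebra_simps)
    moreover have "(p * s) mod q = (p * u) mod q" by (simp add: s_def mod_mult_right_eq)
    ultimately show ?thesis by (simp only: mod_mult_self1)
  qed
  then obtain r where "p * s - 1 = q * r"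
    by (metis mod_eq_dvd_iff dvd_def)
  then have r: "p * s - r * q = 1" by (simp add: algebra_simps)
  define N where "N = q\<^sup>2 + q * s + s\<^sup>2"
  define b where "b = 2 * p * q + p * s + r * q + 2 * r * s"
  define c where "c = p\<^sup>2 + p * r + r\<^sup>2"
  have qs: "0 \<le> q * s" "q * s \<le> q\<^sup>2" "s\<^sup>2 \<le> q\<^sup>2"
    using s assms by (auto simp: power2_eq_square intro: mult_mono)
  show thesis
  proof
    have "4 * N * c - b\<^sup>2 = 3 * (p * s - r * q)\<^sup>2"
      by (simp add: N_def b_def c_def power2_eq_square algebra_simps)
    then show "4 * N * c = b\<^sup>2 + 3" by (simp add: r)
    show N: "q\<^sup>2 \<le> N" "N \<le> 3 * q\<^sup>2"
      using qs zero_le_power2[of s] unfolding N_def by linarith+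
    have N0: "N > 0" using N(1) assms(2) by (smt (verit) zero_less_power)
    have "b * q - 2 * N * p = - (q + 2 * s) * (p * s - r * q)"
      by (simp add: N_def b_def power2_eq_square algebra_simps)
    then have *: "b * q - 2 * N * p = - (q + 2 * s)" by (simp add: r)
    have "b / (2 * N) - p / q = of_int (b * q - 2 * N * p) / (2 * N * q)"
      using N0 assms(2) by (simp add: field_simps)
    then have "\<bar>b / (2 * N) - p / q\<bar> = (q + 2 * s) / (2 * N * q)"
      unfolding * using s assms N0 by (simp add: abs_divide abs_mult)
    also have "\<dots> \<le> (3 * q) / (2 * q\<^sup>2 * q)"
      using s assms N by (intro frac_le) (auto intro!: mult_right_mono simp flip: of_int_power)
    also have "\<dots> = 3 / (2 * q\<^sup>2)" using assms by simp
    finally show "\<bar>b / (2 * N) - p / q\<bar> \<le> 3 / (2 * q\<^sup>2)" by simp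
  qed
qed

text \<open>The bounds on \<open>N\<close> come from fractions \<open>p / q\<close> with \<open>2\<^sup>k / 8 \<le> q \<le> 2\<^sup>k\<close> and \<open>q\<^sup>2 \<le> N \<le> 3 q\<^sup>2\<close>.\<close>

definition hexagonal_level :: "nat \<Rightarrow> real set" where
  "hexagonal_level k = {b / (2 * N) | N b c :: int. 4 * N * c = b\<^sup>2 + 3 \<and> 4 ^ k \<le> 64 * N \<and> N \<le> 3 * 4 ^ k}"

lemma finite_hexagonal_level: "finite (hexagonal_level k \<inter> {u..v})"
proof -
  define B where "B = \<lceil>max \<bar>u\<bar> \<bar>v\<bar>\<rceil> * (6 * 4 ^ k)"
  have "hexagonal_level k \<inter> {u..v} \<subseteq> (\<lambda>(N, b). of_int b / of_int (2 * N)) ` ({1..3 * 4 ^ k} \<times> {-B..B})"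
  proof
    fix x assume x: "x \<in> hexagonal_level k \<inter> {u..v}"
    then obtain N b :: int where N: "x = b / (2 * N)" "4 ^ k \<le> 64 * N" "N \<le> 3 * 4 ^ k"
      by (auto simp: hexagonal_level_def)
    have N0: "N \<ge> 1" using N(2) zero_less_power[of "4 :: int" k] by linarith
    have bx: "real_of_int b = x * (2 * N)" using N(1) N0 by simp
    have "\<bar>x\<bar> \<le> max \<bar>u\<bar> \<bar>v\<bar>" using x by auto
    then have x': "\<bar>x\<bar> \<le> of_int \<lceil>max \<bar>u\<bar> \<bar>v\<bar>\<rceil>" by linarith
    have "real_of_int \<bar>b\<bar> = \<bar>x\<bar> * of_int (2 * N)" using N0 by (simp add: bx abs_mult)
    also have "\<dots> \<le> of_int \<lceil>max \<bar>u\<bar> \<bar>v\<bar>\<rceil> * of_int (6 * 4 ^ k)"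
    proof (rule mult_mono)
      show "real_of_int (2 * N) \<le> of_int (6 * 4 ^ k)" unfolding of_int_le_iff using N by simp
    qed (use x' N0 in auto)
    finally have "\<bar>b\<bar> \<le> B" unfolding B_def by (simp only: of_int_le_iff flip: of_int_mult)
    then show "x \<in> (\<lambda>(N, b). of_int b / of_int (2 * N)) ` ({1..3 * 4 ^ k} \<times> {-B..B})"
      using N N0 by (intro image_eqI[of _ _ "(N, b)"]) auto
  qed
  then show ?thesis by (rule finite_subset) auto
qed

text \<open>Dirichlet gives a fraction with \<open>q \<le> 2 ^ k\<close>. If \<open>q\<close> is
  also at least \<open>2 ^ k / 8\<close>, a hexagonal point near the fraction belongs to level
  \<open>k\<close>; the first alternative is the exceptional one, to be bounded in measure. The
  constant is 8 for the distance from \<open>\<alpha>\<close> to \<open>p / q\<close>, plus 96 = 64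
  * 3 / 2 for the distance from \<open>p / q\<close> to the hexagonal point.\<close>

lemma rational_or_hexagonal_near:
  fixes \<alpha> :: real
  obtains p q :: int where "0 < q" "8 * q < 2 ^ k" "\<bar>q * \<alpha> - p\<bar> < 1 / 2 ^ k"
  | x where "x \<in> hexagonal_level k" "\<bar>\<alpha> - x\<bar> \<le> 104 / 4 ^ k"
proof -
  obtain p q :: int where pq: "coprime p q" "0 < q" "q \<le> int (2 ^ k)" "\<bar>q * \<alpha> - p\<bar> < 1 / real (2 ^ k)"
    using Dirichlet_approx_coprime[of "2 ^ k" \<alpha>] by auto
  show thesis
  proof (cases "8 * q < 2 ^ k")
    case True
    with pq that(1)[of q p] show ?thesis by simp
  next
    case False
    obtain N b c :: int where N: "4 * N * c = b\<^sup>2 + 3" "q\<^sup>2 \<le> N" "N \<le> 3 * q\<^sup>2"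
      "\<bar>b / (2 * N) - p / q\<bar> \<le> 3 / (2 * q\<^sup>2)"
      using hexagonal_near_rational[OF pq(1,2)] .
    have four: "(4 :: 'a :: linordered_idom) ^ k = (2 ^ k) * (2 ^ k)" 
      by (simp flip: power_mult_distrib)
    have "2 ^ k * 2 ^ k \<le> (8 * q) * (8 * q)" 
      using False pq by (intro mult_mono) auto
    then have q1: "4 ^ k \<le> 64 * q\<^sup>2" by (simp add: four power2_eq_square)
    have "q * q \<le> 2 ^ k * 2 ^ k" using pq by (intro mult_mono) auto
    then have q2: "q\<^sup>2 \<le> 4 ^ k" by (simp add: four power2_eq_square)
    have "b / (2 * N) \<in> hexagonal_level k"
      unfolding hexagonal_level_def mem_Collect_eq
      by (rule exI[of _ N], rule exI[of _ b], rule exI[of _ c]) (use N q1 q2 in auto)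
    moreover have "\<bar>\<alpha> - b / (2 * N)\<bar> \<le> 104 / 4 ^ k"
    proof -
      have "\<bar>\<alpha> - p / q\<bar> = \<bar>q * \<alpha> - p\<bar> / q" using pq by (simp add: field_simps abs_divide flip: abs_of_pos)
      also have "\<dots> \<le> (1 / 2 ^ k) / (2 ^ k / 8)"
      proof (rule frac_le)
        have "real_of_int (2 ^ k) \<le> of_int (8 * q)" using False by (simp only: of_int_le_iff)
        then show "2 ^ k / 8 \<le> real_of_int q" by simp
      qed (use pq in auto)
      also have "\<dots> = 8 / 4 ^ k" by (simp add: four)
      finally have 1: "\<bar>\<alpha> - p / q\<bar> \<le> 8 / 4 ^ k" .
      have "real_of_int (4 ^ k) \<le> of_int (64 * q\<^sup>2)" using q1 by (simp only: of_int_le_iff)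
      then have "3 / (2 * (real_of_int q)\<^sup>2) \<le> 96 / 4 ^ k"
        using pq by (simp add: field_simps)
      with 1 N(4) show ?thesis by simp
    qed
    ultimately show ?thesis by (rule that(2))
  qed
qed

section \<open>Numbers well approximated with small denominators\<close>

text \<open>The true growth is logarithmic, but any bound of lower order than \<open>m\<close>
  suffices below, and the square root telescopes.\<close>

lemma sum_inverse_le_sqrt: "(\<Sum>q = 1..m. 1 / real q) \<le> 2 * sqrt m"
proof (induction m)
  case (Suc m)
  have "(sqrt (Suc m) - sqrt m) * (2 * sqrt (Suc m)) \<ge> (sqrt (Suc m) - sqrt m) * (sqrt (Suc m) + sqrt m)"
    by (intro mult_left_mono) auto
  also have "(sqrt (Suc m) - sqrt m) * (sqrt (Suc m) + sqrt m) = 1"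
    by (simp add: algebra_simps)
  finally have "1 / sqrt (Suc m) \<le> 2 * sqrt (Suc m) - 2 * sqrt m"
    by (simp add: field_simps)
  moreover have "1 / real (Suc m) \<le> 1 / sqrt (Suc m)"
    by (intro divide_left_mono) (auto intro: real_le_lsqrt simp: power2_eq_square)
  ultimately show ?case using Suc.IH by simp
qed simp

lemma card_int_interval_le: "real (card {\<lceil>a\<rceil>..\<lfloor>b\<rfloor>}) \<le> b - a + 1" if "a \<le> b" for a b :: real
  using that by simp linarith

lemma measure_finite_UN_intervals_le:
  fixes c :: "'a \<Rightarrow> real" and r :: real
  assumes "finite S" "r \<ge> 0"
  shows "measure lborel (\<Union>i\<in>S. {c i - r..c i + r}) \<le> card S * (2 * r)"
proof -
  have "measure lborel (\<Union>i\<in>S. {c i - r..c i + r}) \<le> (\<Sum>i\<in>S. measure lborel {c i - r..c i + r})"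
    using assms by (intro measure_UNION_le) auto
  also have "\<dots> = card S * (2 * r)" using assms by simp
  finally show ?thesis .
qed

lemma fmeasurable_finite_UN_intervals:
  fixes a b :: "'a \<Rightarrow> real"
  assumes "finite S"
  shows "(\<Union>i\<in>S. {a i..b i}) \<in> fmeasurable lborel"
  using assms by (intro fmeasurable.finite_UN) (auto intro!: fmeasurableI simp: emeasure_lborel_Icc_eq)

text \<open>A denominator \<open>q\<close> contributes about \<open>q * (v - u)\<close> intervals of
  length \<open>2 / (q * 2 ^ k)\<close>, in total \<open>2 * (v - u) / 2 ^ k\<close> whatever
  \<open>q\<close> is. With at most \<open>2 ^ k / 8\<close> denominators this makes a quarter of
  the interval; the rounding error 3 in the number of intervals produces the harmonic sum.\<close>

lemma small_denominator_cover:
  fixes u v :: real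
  assumes "u \<le> v"
  obtains C where "C \<in> fmeasurable lborel" "measure lborel C \<le> (v - u) / 4 + 12 / sqrt (2 ^ k)"
    "\<And>(\<alpha> :: real) (p :: int) (q :: int). \<alpha> \<in> {u..v} \<Longrightarrow> (0 :: int) < q \<Longrightarrow> 8 * q < (2 :: int) ^ k \<Longrightarrow> \<bar>of_int q * \<alpha> - of_int p\<bar> < 1 / 2 ^ k \<Longrightarrow> \<alpha> \<in> C"
proof
  define m :: nat where "m = 2 ^ k div 8"
  \<comment> \<open>The range is widened by 1 on both sides because \<open>p / q\<close> may lie
    slightly outside \<open>{u..v}\<close>.\<close>
  define P where "P = (\<lambda>q :: nat. {\<lceil>q * u - 1\<rceil>..\<lfloor>q * v + 1\<rfloor>})"
  define r where "r = (\<lambda>q :: nat. 1 / (q * 2 ^ k :: real))"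
  define D where "D = (\<lambda>q. \<Union>p\<in>P q. {p / q - r q..p / q + r q})"
  define C where "C = (\<Union>q\<in>{1..m}. D q)"
  have D: "D q \<in> fmeasurable lborel" for q
    unfolding D_def P_def by (rule fmeasurable_finite_UN_intervals) simp
  then show "C \<in> fmeasurable lborel"
    unfolding C_def by (intro fmeasurable.finite_UN) auto
  have m: "real m \<le> 2 ^ k / 8"
    unfolding m_def using of_nat_div_le_of_nat[of "2 ^ k" 8, where 'a = real] by simp
  have Dq: "measure lborel (D q) \<le> 2 * (v - u) / 2 ^ k + 6 / 2 ^ k * (1 / q)" if "q \<in> {1..m}" for q
  proof -
    have q: "real q > 0" using that by simp
    have "measure lborel (D q) \<le> card (P q) * (2 * r q)"
      unfolding D_def
      using measure_finite_UN_intervals_le[of "P q" "r q" "\<lambda>p. p / q"] by (simp add: P_def r_def)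
    also have "\<dots> \<le> (q * (v - u) + 3) * (2 * r q)"
    proof (rule mult_right_mono)
      have "q * u \<le> q * v" using assms by (intro mult_left_mono) auto
      then show "real (card (P q)) \<le> q * (v - u) + 3"
        using card_int_interval_le[of "q * u - 1" "q * v + 1"] by (simp add: P_def algebra_simps)
    qed (simp add: r_def)
    also have "\<dots> = 2 * (v - u) / 2 ^ k + 6 / 2 ^ k * (1 / q)"
      using q by (simp add: r_def field_simps)
    finally show ?thesis .
  qed
  have "measure lborel C \<le> (\<Sum>q\<in>{1..m}. measure lborel (D q))"
    unfolding C_def by (intro measure_UNION_le fmeasurableD D) auto
  also have "\<dots> \<le> (\<Sum>q\<in>{1..m}. 2 * (v - u) / 2 ^ k + 6 / 2 ^ k * (1 / q))"
    using Dq by (rule sum_mono)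
  also have "\<dots> = m * (2 * (v - u) / 2 ^ k) + 6 / 2 ^ k * (\<Sum>q\<in>{1..m}. 1 / real q)"
    by (simp only: sum.distrib sum_distrib_left sum_constant) simp
  also have "\<dots> \<le> (2 ^ k / 8) * (2 * (v - u) / 2 ^ k) + 6 / 2 ^ k * (2 * sqrt (2 ^ k))"
  proof (intro add_mono mult_right_mono mult_left_mono)
    have "real m \<le> 2 ^ k" using m by (rule order_trans) simp
    then have "2 * sqrt m \<le> 2 * sqrt (2 ^ k)" by simp
    with sum_inverse_le_sqrt[of m] show "(\<Sum>q = 1..m. 1 / real q) \<le> 2 * sqrt (2 ^ k)"
      by (rule order_trans)
  qed (use m assms in auto)
  also have "\<dots> = (v - u) / 4 + 12 / sqrt (2 ^ k)"
  proof -
    have "sqrt (2 ^ k) / 2 ^ k = 1 / sqrt (2 ^ k)" by (rule sqrt_divide_self_eq[unfolded inverse_eq_divide]) simp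
    moreover have "6 / 2 ^ k * (2 * sqrt (2 ^ k)) = 12 * (sqrt (2 ^ k) / 2 ^ k)" by simp
    moreover have "(2 ^ k / 8) * (2 * (v - u) / 2 ^ k) = (v - u) / 4" by simp
    ultimately show ?thesis by argo
  qed
  finally show "measure lborel C \<le> (v - u) / 4 + 12 / sqrt (2 ^ k)" .
  fix \<alpha> :: real and p q :: int
  assume \<alpha>: "\<alpha> \<in> {u..v}" and q: "0 < q" "8 * q < 2 ^ k" and near: "\<bar>q * \<alpha> - p\<bar> < 1 / 2 ^ k"
  define n where "n = nat q"
  have qn: "q = int n" "n > 0" using q by (simp_all add: n_def)
  have "int (8 * n) < int (2 ^ k)" using q(2) unfolding qn by simp
  then have "8 * n \<le> 2 ^ k" unfolding of_nat_less_iff by simp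
  then have nm: "n \<in> {1..m}" using qn by (auto simp: m_def less_eq_div_iff_mult_less_eq mult.commute)
  have "\<bar>n * \<alpha> - p\<bar> < 1 / 2 ^ k" using near by (simp add: qn)
  also have "\<dots> \<le> 1" by simp
  finally have "\<bar>n * \<alpha> - p\<bar> < 1" .
  moreover have "n * u \<le> n * \<alpha>" "n * \<alpha> \<le> n * v" using \<alpha> by (auto intro: mult_left_mono)
  ultimately have "p \<in> P n" unfolding P_def atLeastAtMost_iff by linarith
  moreover have "\<bar>\<alpha> - p / n\<bar> \<le> r n"
  proof -
    have "\<bar>\<alpha> - p / n\<bar> = \<bar>n * \<alpha> - p\<bar> / n" using qn by (simp add: field_simps abs_divide flip: abs_of_pos)
    also have "\<dots> \<le> (1 / 2 ^ k) / n" using near by (intro divide_right_mono) (auto simp: qn)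
    finally show ?thesis by (simp add: r_def mult.commute)
  qed
  ultimately have "\<alpha> \<in> D n" unfolding D_def by (auto intro!: bexI[of _ p] simp: abs_le_iff)
  with nm show "\<alpha> \<in> C" by (auto simp: C_def)
qed

section \<open>Separated hexagonal points at every scale\<close>

lemma finite_maximal_separated_subset:
  fixes P :: "'a :: metric_space set"
  assumes "finite P" "\<sigma> > 0"
  obtains M where "M \<subseteq> P" "\<And>x y. x \<in> M \<Longrightarrow> y \<in> M \<Longrightarrow> x \<noteq> y \<Longrightarrow> dist x y \<ge> \<sigma>"
    "\<And>p. p \<in> P \<Longrightarrow> \<exists>x\<in>M. dist p x < \<sigma>"
proof -
  have "\<exists>M\<subseteq>P. (\<forall>x\<in>M. \<forall>y\<in>M. x \<noteq> y \<longrightarrow> dist x y \<ge> \<sigma>) \<and> (\<forall>p\<in>P. \<exists>x\<in>M. dist p x < \<sigma>)"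
    using assms(1)
  proof induction
    case (insert p P)
    then obtain M where M: "M \<subseteq> P" "\<forall>x\<in>M. \<forall>y\<in>M. x \<noteq> y \<longrightarrow> dist x y \<ge> \<sigma>"
      "\<forall>p\<in>P. \<exists>x\<in>M. dist p x < \<sigma>" by blast
    show ?case
    proof (cases "\<exists>x\<in>M. dist p x < \<sigma>")
      case True
      with M show ?thesis by (intro exI[of _ M]) auto
    next
      case False
      with M assms(2) show ?thesis
        by (intro exI[of _ "insert p M"]) (auto simp: not_less dist_commute)
    qed
  qed simp
  with that show thesis by metis
qed

text \<open>For large \<open>k\<close> the exceptional set covers less than half of
  \<open>{u..v}\<close>, so balls about the points of \<open>M\<close> must cover the rest. Each has
  length \<open>210 / 4 ^ k\<close>, which forces at least \<open>(v - u) * 4 ^ k / 420\<close> of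
  them.\<close>

lemma eventually_separated_hexagonal_points:
  fixes u v :: real
  assumes "u < v"
  shows "\<forall>\<^sub>F k in sequentially. \<exists>M \<subseteq> hexagonal_level k. finite M \<and> M \<subseteq> {u - 104 / 4 ^ k..v + 104 / 4 ^ k}
      \<and> (\<forall>x\<in>M. \<forall>y\<in>M. x \<noteq> y \<longrightarrow> \<bar>x - y\<bar> \<ge> 1 / 4 ^ k) \<and> (v - u) * 4 ^ k / 420 \<le> card M"
proof -
  have "(\<lambda>k. 12 / sqrt (2 ^ k)) \<longlonglongrightarrow> 0"
  proof -
    have "(\<lambda>k. 12 * sqrt ((1 / 2) ^ k)) \<longlonglongrightarrow> 12 * sqrt 0"
      by (intro tendsto_intros LIMSEQ_power_zero) auto
    then show ?thesis by (simp add: power_one_over real_sqrt_divide)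
  qed
  then have "\<forall>\<^sub>F k in sequentially. 12 / sqrt (2 ^ k) < (v - u) / 4"
    by (rule order_tendstoD) (use assms in simp)
  then show ?thesis
  proof eventually_elim
    case (elim k)
    obtain C where C: "C \<in> fmeasurable lborel" "measure lborel C \<le> (v - u) / 4 + 12 / sqrt (2 ^ k)"
      "\<And>(\<alpha> :: real) (p :: int) (q :: int). \<alpha> \<in> {u..v} \<Longrightarrow> (0 :: int) < q \<Longrightarrow> 8 * q < (2 :: int) ^ k \<Longrightarrow> \<bar>of_int q * \<alpha> - of_int p\<bar> < 1 / 2 ^ k \<Longrightarrow> \<alpha> \<in> C"
      using small_denominator_cover[of u v k] assms by auto
    let ?P = "hexagonal_level k \<inter> {u - 104 / 4 ^ k..v + 104 / 4 ^ k}"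
    obtain M where M: "M \<subseteq> ?P" "\<And>x y. x \<in> M \<Longrightarrow> y \<in> M \<Longrightarrow> x \<noteq> y \<Longrightarrow> dist x y \<ge> 1 / 4 ^ k"
      "\<And>p. p \<in> ?P \<Longrightarrow> \<exists>x\<in>M. dist p x < 1 / 4 ^ k"
      using finite_maximal_separated_subset[OF finite_hexagonal_level, of "1 / 4 ^ k"] by (metis zero_less_divide_1_iff zero_less_numeral zero_less_power)
    have fin: "finite M" using M(1) finite_hexagonal_level by (rule finite_subset)
    \<comment> \<open>Thinning to a maximal separated subset moves each centre by less than
      \<open>1 / 4 ^ k\<close>, so 104 becomes 105.\<close>
    let ?U = "\<Union>x\<in>M. {x - 105 / 4 ^ k..x + 105 / 4 ^ k}"
    have "{u..v} \<subseteq> C \<union> ?U"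
    proof
      fix \<alpha> assume \<alpha>: "\<alpha> \<in> {u..v}"
      show "\<alpha> \<in> C \<union> ?U"
      proof (cases rule: rational_or_hexagonal_near[of k \<alpha>])
        case (1 p q)
        then show ?thesis using C(3)[OF \<alpha>] by (intro UnI1)
      next
        case (2 x)
        with \<alpha> have "x \<in> ?P" by (auto simp: abs_le_iff)
        then obtain y where "y \<in> M" "dist x y < 1 / 4 ^ k" using M(3) by blast
        moreover have "104 / 4 ^ k + 1 / 4 ^ k = (105 / 4 ^ k :: real)" by (simp add: field_simps)
        ultimately have "\<bar>\<alpha> - y\<bar> \<le> 105 / 4 ^ k" using 2(2) unfolding dist_real_def by linarith
        with \<open>y \<in> M\<close> show ?thesis
          by (intro UnI2 UN_I[of y]) (auto simp: abs_diff_le_iff)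
      qed
    qed
    moreover have U: "?U \<in> fmeasurable lborel" using fin by (rule fmeasurable_finite_UN_intervals)
    ultimately have "measure lborel {u..v} \<le> measure lborel (C \<union> ?U)"
      using C(1) by (intro measure_mono_fmeasurable) auto
    also have "\<dots> \<le> measure lborel C + measure lborel ?U"
      using C(1) U by (intro measure_Un_le) auto
    also have "\<dots> \<le> (v - u) / 2 + card M * (2 * (105 / 4 ^ k))"
    proof -
      have "measure lborel ?U \<le> card M * (2 * (105 / 4 ^ k))"
        using fin by (rule measure_finite_UN_intervals_le) simp
      then show ?thesis using C(2) elim by linarith
    qed
    finally have "v - u \<le> 420 * card M / 4 ^ k"
      using assms by simp argo
    then have "(v - u) * 4 ^ k / 420 \<le> card M" by (simp add: field_simps)
    with M fin show ?case by (intro exI[of _ M]) (auto simp: dist_real_def)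
  qed
qed

section \<open>Measure-theoretic tools\<close>

text \<open>With \<open>N\<close> the number of sets containing a point,
  \<open>2 * l * N - l\<^sup>2 * N\<^sup>2 = 1 - (1 - l * N)\<^sup>2\<close> is at most the
  indicator of the union. Integrating and taking the optimal \<open>l = S1 / S2\<close> gives the
  claim without Cauchy-Schwarz.\<close>

lemma Chung_Erdos_inequality:
  fixes A :: "'i \<Rightarrow> 'a set"
  assumes K: "finite K" and A: "\<And>i. i \<in> K \<Longrightarrow> A i \<in> fmeasurable M"
  shows "(\<Sum>i\<in>K. measure M (A i))\<^sup>2 \<le>
           measure M (\<Union>i\<in>K. A i) * (\<Sum>i\<in>K. \<Sum>j\<in>K. measure M (A i \<inter> A j))"
proof -
  let ?U = "\<Union>i\<in>K. A i"
  define S1 where "S1 = (\<Sum>i\<in>K. measure M (A i))"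
  define S2 where "S2 = (\<Sum>i\<in>K. \<Sum>j\<in>K. measure M (A i \<inter> A j))"
  have U: "?U \<in> fmeasurable M" using assms by (intro fmeasurable.finite_UN)
  have AA: "A i \<inter> A j \<in> fmeasurable M" if "i \<in> K" "j \<in> K" for i j
    using A that by (meson fmeasurable.Int)
  have ind: "integrable M (indicator B :: _ \<Rightarrow> real)" "integral\<^sup>L M (indicator B :: _ \<Rightarrow> real) = measure M B"
    if "B \<in> fmeasurable M" for B
  proof -
    have "emeasure M B < \<infinity>" "B \<in> sets M" using that by (auto simp: fmeasurable_def)
    then show "integrable M (indicator B :: _ \<Rightarrow> real)" by (rule integrable_real_indicator[OF _ _, rotated])
    show "integral\<^sup>L M (indicator B :: _ \<Rightarrow> real) = measure M B"
      using \<open>B \<in> sets M\<close> sets.sets_into_space by (simp add: Int_absorb2)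
  qed
  have *: "2 * l * S1 - l\<^sup>2 * S2 \<le> measure M ?U" for l
  proof -
    let ?F = "\<lambda>x. 2 * l * (\<Sum>i\<in>K. indicator (A i) x) - l\<^sup>2 * (\<Sum>i\<in>K. \<Sum>j\<in>K. indicator (A i \<inter> A j) x) :: real"
    have "integral\<^sup>L M ?F \<le> integral\<^sup>L M (indicator ?U :: _ \<Rightarrow> real)"
    proof (rule integral_mono)
      show "integrable M ?F" using A AA ind by auto
      show "integrable M (indicator ?U :: _ \<Rightarrow> real)" using U ind by auto
      fix x
      define N where "N = (\<Sum>i\<in>K. indicator (A i) x :: real)"
      have "?F x = 2 * l * N - l\<^sup>2 * N\<^sup>2"
        by (simp add: N_def power2_eq_square sum_product indicator_inter_arith)
      also have "\<dots> = 1 - (1 - l * N)\<^sup>2" by (simp add: power2_eq_square algebra_simps)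
      also have "\<dots> \<le> indicator ?U x"
      proof (cases "x \<in> ?U")
        case False
        then have "N = 0" by (auto simp: N_def)
        with False show ?thesis by simp
      qed simp
      finally show "?F x \<le> indicator ?U x" .
    qed
    also have "integral\<^sup>L M ?F = 2 * l * S1 - l\<^sup>2 * S2"
      using A AA ind by (simp add: S1_def S2_def)
    finally show ?thesis using ind(2)[OF U] by simp
  qed
  \<comment> \<open>This settles the degenerate case \<open>S2 = 0\<close>, where the optimal
    \<open>l\<close> is undefined.\<close>
  have "S1 \<le> S2"
    unfolding S1_def S2_def
  proof (rule sum_mono)
    fix i assume "i \<in> K"
    then show "measure M (A i) \<le> (\<Sum>j\<in>K. measure M (A i \<inter> A j))"
      using member_le_sum[of i K "\<lambda>j. measure M (A i \<inter> A j)"] K by simp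
  qed
  moreover have "S1 \<ge> 0" by (simp add: S1_def sum_nonneg)
  ultimately have "S1\<^sup>2 \<le> measure M ?U * S2"
  proof (cases "S2 = 0")
    case False
    with \<open>S1 \<ge> 0\<close> \<open>S1 \<le> S2\<close> have "S2 > 0" by simp
    have "S1\<^sup>2 / S2 \<le> measure M ?U"
      using *[of "S1 / S2"] \<open>S2 > 0\<close> by (simp add: power2_eq_square)
    with \<open>S2 > 0\<close> show ?thesis by (simp add: field_simps)
  qed auto
  then show ?thesis by (simp add: S1_def S2_def)
qed

text \<open>Cells of length \<open>\<sigma>\<close>, indexed by a floor, contain at most one point
  each.\<close>

lemma card_separated_le:
  fixes S :: "real set"
  assumes "\<sigma> > 0" "a \<le> b" "S \<subseteq> {a..b}" "\<And>x y. x \<in> S \<Longrightarrow> y \<in> S \<Longrightarrow> x \<noteq> y \<Longrightarrow> \<sigma> \<le> \<bar>x - y\<bar>"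
  shows "real (card S) \<le> (b - a) / \<sigma> + 1"
proof -
  let ?f = "\<lambda>x. \<lfloor>(x - a) / \<sigma>\<rfloor>"
  have inj: "inj_on ?f S"
  proof (rule inj_onI, rule ccontr)
    fix x y assume xy: "x \<in> S" "y \<in> S" "?f x = ?f y" "x \<noteq> y"
    have "\<bar>(x - a) / \<sigma> - (y - a) / \<sigma>\<bar> < 1" using xy(3) by linarith
    moreover have "(x - a) / \<sigma> - (y - a) / \<sigma> = (x - y) / \<sigma>" by (simp add: diff_divide_distrib)
    ultimately have "\<bar>x - y\<bar> < \<sigma>" using assms(1) by (simp add: abs_divide)
    with assms(4)[OF xy(1,2,4)] show False by simp
  qed
  have "?f ` S \<subseteq> {0..\<lfloor>(b - a) / \<sigma>\<rfloor>}"
    using assms(1,3) by (fastforce intro!: floor_mono divide_right_mono)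
  then have "card (?f ` S) \<le> card {0..\<lfloor>(b - a) / \<sigma>\<rfloor>}" by (intro card_mono) auto
  also have "\<dots> = nat (\<lfloor>(b - a) / \<sigma>\<rfloor> + 1)" by simp
  finally have "card S \<le> nat (\<lfloor>(b - a) / \<sigma>\<rfloor> + 1)" by (simp add: card_image inj)
  moreover have "(b - a) / \<sigma> \<ge> 0" using assms by simp
  ultimately show ?thesis by linarith
qed

section \<open>Sets that are uniformly thin in all intervals\<close>

lemma bounded_open_connected_eq_interval:
  fixes V :: "real set"
  assumes "open V" "connected V" "bounded V"
  obtains a b where "V = {a<..<b}"
proof -
  have "convex V" using assms(2) is_interval_connected_1 is_interval_convex_1 by blast
  have "compact (closure V)" "connected (closure V)"
    using assms by (auto intro: connected_imp_connected_closure)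
  then obtain a b where "closure V = {a..b}"
    using connected_compact_interval_1 by blast
  then have "V = {a<..<b}"
    using convex_interior_closure[OF \<open>convex V\<close>] assms(1) by (simp add: interior_open)
  with that show thesis by blast
qed

text \<open>An open set is the disjoint union of its countably many components, and these are
  intervals, so the hypothesis can be summed.\<close>

lemma emeasure_Int_open_le:
  fixes B :: "real set"
  assumes B: "B \<in> sets borel" and c: "0 \<le> c"
    and thin: "\<And>u v. u < v \<Longrightarrow> measure lborel (B \<inter> {u<..<v}) \<le> c * (v - u)"
    and U: "open U" "bounded U"
  shows "emeasure lborel (B \<inter> U) \<le> ennreal c * emeasure lborel U"
proof -
  have disj: "disjoint_family_on (\<lambda>V. V) (components U)"
    using pairwise_disjoint_components[of U] by (auto simp: disjoint_family_on_def pairwise_def disjnt_def)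
  have op: "open V" if "V \<in> components U" for V using that U(1) by (rule open_components[rotated])
  have cnt: "countable (components U)"
    using op pairwise_disjoint_components[of U]
    by (intro countable_disjoint_open_subsets) (auto simp: pairwise_def disjnt_def)
  have comp: "emeasure lborel (B \<inter> V) \<le> ennreal c * emeasure lborel V" if VU: "V \<in> components U" for V
  proof -
    have "bounded V" using that U(2) bounded_subset in_components_subset by blast
    then obtain a b where V: "V = {a<..<b}"
      by (rule bounded_open_connected_eq_interval[OF op[OF VU] in_components_connected[OF VU]])
    then have "a < b" using in_components_nonempty[OF that] by auto
    have "emeasure lborel (B \<inter> V) = ennreal (measure lborel (B \<inter> V))"
    proof (rule emeasure_eq_ennreal_measure)
      have "emeasure lborel (B \<inter> V) \<le> emeasure lborel V" using B op that by (intro emeasure_mono) auto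
      also have "\<dots> < top" using \<open>a < b\<close> by (simp add: V)
      finally show "emeasure lborel (B \<inter> V) \<noteq> top" by simp
    qed
    also have "\<dots> \<le> ennreal (c * (b - a))" using thin[OF \<open>a < b\<close>] unfolding V by (rule ennreal_leI)
    also have "\<dots> = ennreal c * emeasure lborel V" using \<open>a < b\<close> c by (simp add: V ennreal_mult)
    finally show ?thesis .
  qed
  have UC: "(\<Union>V\<in>components U. V) = U" using Union_components[of U] by simp
  then have "(\<Union>V\<in>components U. B \<inter> V) = B \<inter> U" by blast
  then have "emeasure lborel (B \<inter> U) = emeasure lborel (\<Union>V\<in>components U. B \<inter> V)" by simp
  also have "\<dots> = (\<integral>\<^sup>+V. emeasure lborel (B \<inter> V) \<partial>count_space (components U))"
    using disj B op cnt by (intro emeasure_UN_countable) (auto simp: disjoint_family_on_def)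
  also have "\<dots> \<le> (\<integral>\<^sup>+V. ennreal c * emeasure lborel V \<partial>count_space (components U))"
    using comp by (intro nn_integral_mono) auto
  also have "\<dots> = ennreal c * (\<integral>\<^sup>+V. emeasure lborel V \<partial>count_space (components U))"
    by (intro nn_integral_cmult) auto
  also have "(\<integral>\<^sup>+V. emeasure lborel V \<partial>count_space (components U)) = emeasure lborel (\<Union>V\<in>components U. V)"
    using disj op cnt by (intro emeasure_UN_countable[symmetric]) auto
  finally show ?thesis unfolding UC .
qed

text \<open>A substitute for the Lebesgue density theorem: if a bounded piece had measure
  \<open>m > 0\<close>, outer regularity would enclose it in an open \<open>W\<close> of measure
  barely above \<open>m\<close>, yet thinness on \<open>W\<close> gives
  \<open>m \<le> c * measure W < m\<close>.\<close>

lemma null_sets_if_uniformly_thin: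
  fixes B :: "real set"
  assumes B: "B \<in> sets borel" and c: "0 \<le> c" "c < 1"
    and thin: "\<And>u v. u < v \<Longrightarrow> measure lborel (B \<inter> {u<..<v}) \<le> c * (v - u)"
  shows "B \<in> null_sets lborel"
proof -
  have null: "B \<inter> {-real n<..<real n} \<in> null_sets lborel" for n
  proof (rule ccontr)
    define m where "m = measure lborel (B \<inter> {-real n<..<real n})"
    assume "B \<inter> {-real n<..<real n} \<notin> null_sets lborel"
    moreover have fm: "B \<inter> {-real n<..<real n} \<in> fmeasurable lborel"
      using B by (intro fmeasurable_Int_fmeasurable[of "{-real n<..<real n}" _ B, simplified Int_commute[of _ B]] fmeasurableI) auto
    ultimately have m: "m > 0" "emeasure lborel (B \<inter> {-real n<..<real n}) = ennreal m"
      unfolding m_def by (auto simp: emeasure_eq_measure2 null_sets_def zero_less_measure_iff)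
    \<comment> \<open>The slack \<open>\<delta> = (1 - c) * m / 2\<close> is chosen so that
      \<open>c * (m + \<delta>) < m\<close>.\<close>
    obtain U where U: "open U" "B \<inter> {-real n<..<real n} \<subseteq> U"
      "emeasure lborel (U - B \<inter> {-real n<..<real n}) < ennreal ((1 - c) * m / 2)"
      using outer_regular_lborel[of "B \<inter> {-real n<..<real n}" "(1 - c) * m / 2"] B c m by auto
    define W where "W = U \<inter> {-real n<..<real n}"
    have W: "open W" "bounded W"
      using U(1) bounded_box[of "-real n" "real n"]
      by (auto simp: W_def open_Int box_real(1) simp del: bounded_box intro: bounded_subset)
    have BW: "B \<inter> W = B \<inter> {-real n<..<real n}" using U(2) by (auto simp: W_def)
    have "emeasure lborel W \<le> emeasure lborel (B \<inter> {-real n<..<real n} \<union> (U - B \<inter> {-real n<..<real n}))"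
      using B U(1) by (intro emeasure_mono) (auto simp: W_def)
    also have "\<dots> \<le> emeasure lborel (B \<inter> {-real n<..<real n}) + emeasure lborel (U - B \<inter> {-real n<..<real n})"
      using B U(1) by (intro emeasure_subadditive) auto
    also have "\<dots> \<le> ennreal m + ennreal ((1 - c) * m / 2)"
      unfolding m(2) using U(3) by (intro add_mono) auto
    finally have "emeasure lborel W \<le> ennreal (m + (1 - c) * m / 2)"
      using m c by simp
    then have "ennreal c * emeasure lborel W \<le> ennreal (c * (m + (1 - c) * m / 2))"
      using c m by (simp add: ennreal_mult mult_left_mono)
    moreover have "ennreal m \<le> ennreal c * emeasure lborel W"
      using emeasure_Int_open_le[OF B c(1) thin W] by (simp add: BW m)
    ultimately have "ennreal m \<le> ennreal (c * (m + (1 - c) * m / 2))" by (rule order_trans[rotated])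
    moreover have "c * (m + (1 - c) * m / 2) \<ge> 0" using m c by simp
    ultimately have "m \<le> c * (m + (1 - c) * m / 2)" using ennreal_le_iff by blast
    moreover have "c * (m + (1 - c) * m / 2) < m"
    proof -
      have "m - c * (m + (1 - c) * m / 2) = (1 - c) * m * (1 - c / 2)" by (simp add: algebra_simps)
      also have "\<dots> > 0" using m c by simp
      finally show ?thesis by simp
    qed
    ultimately show False by simp
  qed
  have "B = (\<Union>n. B \<inter> {-real n<..<real n})"
  proof (intro equalityI subsetI)
    fix x assume "x \<in> B"
    obtain n where "\<bar>x\<bar> < real n" using reals_Archimedean2 by blast
    with \<open>x \<in> B\<close> show "x \<in> (\<Union>n. B \<inter> {-real n<..<real n})" by (auto intro!: exI[of _ n])
  qed auto
  also have "\<dots> \<in> null_sets lborel" by (intro null_sets_UN null)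
  finally show ?thesis .
qed

text \<open>
  Close pairs from different levels \<open>j < k\<close> cost \<open>e\<^sub>k 4\<^sup>j\<^sup>-\<^sup>k\<close>, which is summable over \<open>j\<close>;
  otherwise the two levels are independent up to a constant.
\<close>

lemma separated_balls_union_thick:
  fixes S :: "nat \<Rightarrow> real set" and e :: "nat \<Rightarrow> real"
  defines "A \<equiv> \<lambda>k. \<Union>x\<in>S k. {x - e k / 4 ^ Suc k..x + e k / 4 ^ Suc k}"
  assumes L: "L > 0"
    and S: "\<And>k. m \<le> k \<Longrightarrow> finite (S k)" "\<And>k. m \<le> k \<Longrightarrow> S k \<subseteq> {w..w + 2 * L}"
      "\<And>k x y. m \<le> k \<Longrightarrow> x \<in> S k \<Longrightarrow> y \<in> S k \<Longrightarrow> x \<noteq> y \<Longrightarrow> 1 / 4 ^ k \<le> \<bar>x - y\<bar>"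
      "\<And>k. m \<le> k \<Longrightarrow> L * 4 ^ k / 420 \<le> card (S k)"
    and large: "\<And>k. m \<le> k \<Longrightarrow> 1 \<le> L * 4 ^ k"
    and e: "\<And>k. 0 \<le> e k" "\<And>k. e k \<le> 1" "decseq e" "\<not> summable e"
  obtains n where "L / (6 * 840\<^sup>2) \<le> measure lborel (\<Union>k\<in>{m..<n}. A k)"
proof -
  define r where "r = (\<lambda>k. e k / 4 ^ Suc k)"
  have r0: "r k \<ge> 0" for k using e(1) by (simp add: r_def)
  have two_r: "2 * r k = e k / (2 * 4 ^ k)" for k by (simp add: r_def)
  have A_eq: "A k = (\<Union>x\<in>S k. {x - r k..x + r k})" for k by (simp add: A_def r_def)
  have A: "A k \<in> fmeasurable lborel" if "m \<le> k" for k
    unfolding A_def using S(1)[OF that] by (rule fmeasurable_finite_UN_intervals)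
  have card_le: "real (card (S k \<inter> {a..b})) \<le> (b - a) * 4 ^ k + 1" if "m \<le> k" "a \<le> b" for a b :: real and k
    using card_separated_le[of "1 / 4 ^ k" a b "S k \<inter> {a..b}"] S(3) that by simp
  \<comment> \<open>An interval of length \<open>2 * L\<close> gives at most
    \<open>2 * L * 4 ^ k + 1\<close> points; the 1 is absorbed by \<open>large\<close>.\<close>
  have card3: "card (S k) \<le> 3 * L * 4 ^ k" if "m \<le> k" for k
    using card_le[OF that, of w "w + 2 * L"] S(2)[OF that] large[OF that] L by (simp add: Int_absorb2)
  \<comment> \<open>The intervals of one level have length at most \<open>1 / (2 * 4 ^ k)\<close>,
    half the separation of their centres, and are therefore disjoint.\<close>
  have lower: "L * e k / 840 \<le> measure lborel (A k)" if "m \<le> k" for k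
  proof -
    have "L * e k / 840 = (L * 4 ^ k / 420) * (2 * r k)" by (simp add: two_r)
    also have "\<dots> \<le> card (S k) * (2 * r k)" using S(4)[OF that] r0 by (intro mult_right_mono) auto
    also have "\<dots> = (\<Sum>x\<in>S k. measure lborel {x - r k..x + r k})" using r0[of k] by simp
    also have "\<dots> = measure lborel (\<Union>x\<in>S k. {x - r k..x + r k})"
    proof (intro measure_finite_Union[symmetric] S(1)[OF that])
      have "2 * r k < 1 / 4 ^ k"
      proof -
        have "e k / (2 * 4 ^ k) \<le> 1 / (2 * 4 ^ k)" using e(2) by (intro divide_right_mono) auto
        also have "\<dots> < 1 / 4 ^ k" by (intro divide_strict_left_mono) auto
        finally show ?thesis by (simp only: two_r)
      qed
      then show "disjoint_family_on (\<lambda>x. {x - r k..x + r k}) (S k)"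
        unfolding disjoint_family_on_def using S(3)[OF that]
        by (smt (verit, best) atLeastAtMost_iff disjoint_iff)
    qed (auto simp: emeasure_lborel_Icc_eq split: if_splits)
    finally show ?thesis by (simp add: A_eq)
  qed
  have upper: "measure lborel (A j \<inter> A k) \<le> 3 / 2 * L * (e j * e k + e k * (4 ^ j / 4 ^ k))"
    if jk: "m \<le> j" "j < k" for j k
  proof -
    have "r k \<le> r j"
      unfolding r_def using e(1,3) jk by (intro frac_le) (auto simp: decseq_def power_increasing)
    \<comment> \<open>\<open>V x\<close> collects the finer intervals that can meet the coarse one
      around \<open>x\<close>: their centres lie within \<open>r j + r k \<le> 2 * r j\<close>.
      Separation bounds their number by \<open>4 * r j * 4 ^ k + 1\<close>, in which the first term
      gives independence and the 1 is the cost of a close pair.\<close>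
    define V where "V = (\<lambda>x. \<Union>y\<in>S k \<inter> {x - 2 * r j..x + 2 * r j}. {y - r k..y + r k})"
    have fin: "finite (S k \<inter> T)" for T using S(1) jk by simp
    have V: "V x \<in> fmeasurable lborel" for x
      unfolding V_def using fin by (rule fmeasurable_finite_UN_intervals)
    have "A j \<inter> A k \<subseteq> (\<Union>x\<in>S j. V x)"
    proof
      fix z assume "z \<in> A j \<inter> A k"
      then obtain x y where xy: "x \<in> S j" "x - r j \<le> z" "z \<le> x + r j"
        "y \<in> S k" "y - r k \<le> z" "z \<le> y + r k"
        by (auto simp: A_eq)
      then have "y \<in> S k \<inter> {x - 2 * r j..x + 2 * r j}" using \<open>r k \<le> r j\<close> by auto
      moreover have "z \<in> {y - r k..y + r k}" using xy by simp
      ultimately have "z \<in> V x" unfolding V_def by (rule UN_I)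
      with xy(1) show "z \<in> (\<Union>x\<in>S j. V x)" by (rule UN_I)
    qed
    then have "measure lborel (A j \<inter> A k) \<le> measure lborel (\<Union>x\<in>S j. V x)"
      using V A jk S(1)
      by (intro measure_mono_fmeasurable fmeasurable.finite_UN) (auto intro: fmeasurableD)
    also have "\<dots> \<le> (\<Sum>x\<in>S j. measure lborel (V x))"
      using S(1) jk by (intro measure_UNION_le fmeasurableD V) auto
    also have "\<dots> \<le> (\<Sum>x\<in>S j. (e j * 4 ^ k / 4 ^ j + 1) * (e k / (2 * 4 ^ k)))"
    proof (rule sum_mono)
      fix x
      have "measure lborel (V x) \<le> card (S k \<inter> {x - 2 * r j..x + 2 * r j}) * (2 * r k)"
        unfolding V_def by (rule measure_finite_UN_intervals_le[OF fin r0])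
      also have "\<dots> \<le> ((x + 2 * r j - (x - 2 * r j)) * 4 ^ k + 1) * (2 * r k)"
        using jk r0[of j] r0[of k] by (intro mult_right_mono card_le) auto
      also have "\<dots> = (e j * 4 ^ k / 4 ^ j + 1) * (e k / (2 * 4 ^ k))"
        by (simp add: r_def field_simps)
      finally show "measure lborel (V x) \<le> (e j * 4 ^ k / 4 ^ j + 1) * (e k / (2 * 4 ^ k))" .
    qed
    also have "\<dots> = card (S j) * ((e j * 4 ^ k / 4 ^ j + 1) * (e k / (2 * 4 ^ k)))"
      by simp
    also have "\<dots> \<le> 3 * L * 4 ^ j * ((e j * 4 ^ k / 4 ^ j + 1) * (e k / (2 * 4 ^ k)))"
      using card3[OF jk(1)] e(1) by (intro mult_right_mono) auto
    also have "\<dots> = 3 / 2 * L * (e j * e k + e k * (4 ^ j / 4 ^ k))"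
      by (simp add: field_simps)
    finally show ?thesis .
  qed
  have diag: "measure lborel (A k) \<le> 3 / 2 * L * e k" if "m \<le> k" for k
  proof -
    have "measure lborel (A k) \<le> card (S k) * (2 * r k)"
      unfolding A_eq by (rule measure_finite_UN_intervals_le[OF S(1)[OF that] r0])
    also have "\<dots> \<le> 3 * L * 4 ^ k * (2 * r k)"
      using card3[OF that] r0 by (intro mult_right_mono) auto
    finally show ?thesis by (simp add: two_r)
  qed
  \<comment> \<open>One-sided, so that \<open>g j k + g k j\<close> is the right correction in
    either order of the levels; on the diagonal it is \<open>2 * e k\<close>, enough for the trivial
    bound there.\<close>
  define g where "g = (\<lambda>j k. if j \<le> k then e k * (4 ^ j / 4 ^ k) else 0)"
  have pair: "measure lborel (A j \<inter> A k) \<le> 3 / 2 * L * (e j * e k + (g j k + g k j))"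
    if "m \<le> j" "m \<le> k" for j k
  proof (cases j k rule: linorder_cases)
    case less
    then show ?thesis using upper[OF that(1) less] by (simp add: g_def)
  next
    case greater
    then show ?thesis using upper[OF that(2) greater] by (simp add: g_def Int_commute mult.commute)
  next
    case equal
    have "measure lborel (A k) \<le> 3 / 2 * L * e k" using diag that by simp
    also have "\<dots> \<le> 3 / 2 * L * (e k * e k + (g k k + g k k))"
      using L e(1)[of k] by (intro mult_left_mono) (auto simp: g_def)
    finally show ?thesis using equal by simp
  qed
  \<comment> \<open>Once the sum \<open>s\<close> reaches 1, the linear correction
    \<open>8 / 3 * s\<close> is absorbed:
    \<open>s\<^sup>2 + 8 / 3 * s \<le> 4 * s\<^sup>2\<close>.\<close>
  obtain n where n: "1 \<le> sum e {m..<n}"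
  proof (rule ccontr)
    assume "\<not> thesis"
    with that have "sum e {m..<n} < 1" for n by (meson not_le)
    moreover have "sum e {..<n} \<le> sum e {..<m} + sum e {m..<n}" for n
    proof -
      have "sum e {..<n} \<le> sum e ({..<m} \<union> {m..<n})" using e(1) by (intro sum_mono2) auto
      also have "\<dots> \<le> sum e {..<m} + sum e {m..<n}" using e(1) by (subst sum.union_disjoint) auto
      finally show ?thesis .
    qed
    ultimately have "sum e {..<n} \<le> sum e {..<m} + 1" for n by (meson add_left_mono less_imp_le order_trans)
    then have "sum e {..n} \<le> sum e {..<m} + 1" for n unfolding lessThan_Suc_atMost[symmetric] by blast
    then have "summable e" using e(1) by (intro bounded_imp_summable)
    with e(4) show False by simp
  qed
  define s where "s = sum e {m..<n}"
  have gsum: "(\<Sum>j\<in>{m..<n}. \<Sum>k\<in>{m..<n}. g j k) \<le> 4 / 3 * s"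
  proof -
    have "(\<Sum>j\<in>{m..<n}. \<Sum>k\<in>{m..<n}. g j k) = (\<Sum>k\<in>{m..<n}. \<Sum>j\<in>{m..<n}. g j k)" by (rule sum.swap)
    also have "\<dots> \<le> (\<Sum>k\<in>{m..<n}. 4 / 3 * e k)"
    proof (rule sum_mono)
      fix k
      have "(\<Sum>j\<in>{m..<n}. g j k) = (\<Sum>j\<in>{m..<n} \<inter> {..k}. e k * (4 ^ j / 4 ^ k))"
        unfolding g_def by (subst sum.inter_restrict) (auto intro: sum.cong)
      also have "\<dots> \<le> (\<Sum>j\<in>{..k}. e k * (4 ^ j / 4 ^ k))"
        using e(1) by (intro sum_mono2) auto
      also have "\<dots> = e k / 4 ^ k * (\<Sum>j\<in>{..k}. 4 ^ j)"
        by (simp add: sum_distrib_left)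
      also have "(\<Sum>j\<in>{..k}. (4 :: real) ^ j) \<le> 4 / 3 * 4 ^ k"
        by (simp add: sum_gp0 field_simps)
      then have "e k / 4 ^ k * (\<Sum>j\<in>{..k}. 4 ^ j) \<le> e k / 4 ^ k * (4 / 3 * 4 ^ k)"
        using e(1) by (intro mult_left_mono) auto
      finally show "(\<Sum>j\<in>{m..<n}. g j k) \<le> 4 / 3 * e k" by simp
    qed
    finally show ?thesis by (simp add: s_def sum_distrib_left)
  qed
  have "(\<Sum>j\<in>{m..<n}. \<Sum>k\<in>{m..<n}. measure lborel (A j \<inter> A k)) \<le>
      (\<Sum>j\<in>{m..<n}. \<Sum>k\<in>{m..<n}. 3 / 2 * L * (e j * e k + (g j k + g k j)))"
    by (intro sum_mono pair) auto
  also have "\<dots> = 3 / 2 * L * (s * s + 2 * (\<Sum>j\<in>{m..<n}. \<Sum>k\<in>{m..<n}. g j k))"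
  proof -
    have "(\<Sum>j\<in>{m..<n}. \<Sum>k\<in>{m..<n}. g k j) = (\<Sum>j\<in>{m..<n}. \<Sum>k\<in>{m..<n}. g j k)" by (rule sum.swap)
    then have "(\<Sum>j\<in>{m..<n}. \<Sum>k\<in>{m..<n}. e j * e k + (g j k + g k j)) =
        s * s + 2 * (\<Sum>j\<in>{m..<n}. \<Sum>k\<in>{m..<n}. g j k)"
      by (simp add: sum.distrib s_def sum_product)
    then show ?thesis by (simp only: sum_distrib_left[symmetric])
  qed
  also have "\<dots> \<le> 3 / 2 * L * (s * s + 2 * (4 / 3 * s))"
    using L gsum by (intro mult_left_mono) auto
  also have "\<dots> \<le> 3 / 2 * L * (4 * s\<^sup>2)"
  proof -
    have "1 * s \<le> s * s" using n by (intro mult_right_mono) (auto simp: s_def)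
    moreover have "s \<ge> 1" using n by (simp add: s_def)
    ultimately have "s * s + 2 * (4 / 3 * s) \<le> 4 * s\<^sup>2" unfolding power2_eq_square by argo
    then show ?thesis using L by (intro mult_left_mono) auto
  qed
  finally have S2: "(\<Sum>j\<in>{m..<n}. \<Sum>k\<in>{m..<n}. measure lborel (A j \<inter> A k)) \<le> 6 * L * s\<^sup>2" by simp
  let ?U = "\<Union>k\<in>{m..<n}. A k"
  have "L / 840 * s \<le> (\<Sum>k\<in>{m..<n}. measure lborel (A k))"
    unfolding s_def sum_distrib_left using lower by (intro sum_mono) auto
  then have "(L / 840 * s)\<^sup>2 \<le> (\<Sum>k\<in>{m..<n}. measure lborel (A k))\<^sup>2"
    using L n by (intro power_mono) (auto simp: s_def)
  also have "\<dots> \<le> measure lborel ?U * (\<Sum>j\<in>{m..<n}. \<Sum>k\<in>{m..<n}. measure lborel (A j \<inter> A k))"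
    using A by (intro Chung_Erdos_inequality) auto
  also have "\<dots> \<le> measure lborel ?U * (6 * L * s\<^sup>2)"
    using S2 by (intro mult_left_mono) auto
  finally have "L * (L * s\<^sup>2) / 840\<^sup>2 \<le> measure lborel ?U * 6 * (L * s\<^sup>2)"
    by (simp add: power_mult_distrib power_divide power2_eq_square mult_ac)
  moreover have "L * s\<^sup>2 > 0" using L n by (simp add: s_def)
  ultimately have "L / 840\<^sup>2 \<le> measure lborel ?U * 6"
    by (simp only: times_divide_eq_left[symmetric] mult_le_cancel_right_pos)
  then have "L / (6 * 840\<^sup>2) \<le> measure lborel ?U" by simp
  then show thesis by (rule that)
qed

section \<open>The divergence case\<close>

lemma countable_hexagonal_level: "countable (hexagonal_level k)"
proof (rule countable_subset)
  show "hexagonal_level k \<subseteq> range (\<lambda>(N, b). real_of_int b / real_of_int (2 * N))"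
    unfolding hexagonal_level_def by auto
qed auto

text \<open>Every tail union \<open>D m\<close> fills a proportion \<open>c\<close> of every
  interval, where \<open>c\<close> depends neither on \<open>m\<close> nor on the interval. The
  limsup set inherits this, so its complement is uniformly thin.\<close>

lemma hexagonal_limsup_complement_null:
  fixes e :: "nat \<Rightarrow> real"
  assumes e: "\<And>k. 0 \<le> e k" "\<And>k. e k \<le> 1" "decseq e" "\<not> summable e"
  shows "- {\<alpha>. \<forall>m. \<exists>k\<ge>m. \<exists>x\<in>hexagonal_level k. \<bar>\<alpha> - x\<bar> \<le> e k / 4 ^ Suc k} \<in> null_sets lborel"
    (is "- ?E \<in> _")
proof -
  define G where "G = (\<lambda>k. \<Union>x\<in>hexagonal_level k. {x - e k / 4 ^ Suc k..x + e k / 4 ^ Suc k})"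
  define D where "D = (\<lambda>m. \<Union>k\<in>{m..}. G k)"
  have G: "G k \<in> sets borel" for k
    unfolding G_def using countable_hexagonal_level by (intro sets.countable_UN') auto
  have D: "D m \<in> sets borel" for m
    unfolding D_def using G by (intro sets.countable_UN') auto
  have "?E = (\<Inter>m. D m)"
    unfolding D_def G_def by (rule set_eqI) (simp add: abs_diff_le_iff Bex_def)
  moreover have "- (\<Inter>m. D m) \<in> null_sets lborel"
  proof (rule null_sets_if_uniformly_thin)
    show "- (\<Inter>m. D m) \<in> sets borel" using D by (intro borel_comp sets.countable_INT) auto
    define c :: real where "c = 1 / (12 * 840\<^sup>2)"
    show "0 \<le> 1 - c" "1 - c < 1" by (simp_all add: c_def)
    fix u v :: real assume "u < v"
    \<comment> \<open>Centres are sought around the middle half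
      \<open>{u + L / 2..u + 3 * L / 2}\<close>, of length \<open>L\<close>. The margins
      \<open>L / 2\<close> accommodate both their overshoot \<open>104 / 4 ^ k\<close> and the radii
      of the balls.\<close>
    define L where "L = (v - u) / 2"
    have L: "L > 0" and v: "v = u + 2 * L" using \<open>u < v\<close> by (auto simp: L_def field_simps)
    have "(\<lambda>k. 105 * (1 / 4) ^ k) \<longlonglongrightarrow> (105 * 0 :: real)"
      by (intro tendsto_intros LIMSEQ_power_zero) auto
    then have "\<forall>\<^sub>F k in sequentially. 105 * (1 / 4) ^ k < L / 2"
      by (rule order_tendstoD) (use L in simp)
    moreover define good where "good = (\<lambda>k M. M \<subseteq> hexagonal_level k \<and> finite M
      \<and> M \<subseteq> {u + L / 2 - 104 / 4 ^ k..u + 3 * L / 2 + 104 / 4 ^ k}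
      \<and> (\<forall>x\<in>M. \<forall>y\<in>M. x \<noteq> y \<longrightarrow> \<bar>x - y\<bar> \<ge> 1 / 4 ^ k)
      \<and> (u + 3 * L / 2 - (u + L / 2)) * 4 ^ k / 420 \<le> card M)"
    moreover have "\<forall>\<^sub>F k in sequentially. \<exists>M. good k M"
      unfolding good_def by (rule eventually_separated_hexagonal_points) (use L in simp)
    ultimately have "\<forall>\<^sub>F k in sequentially. 105 * (1 / 4) ^ k < L / 2 \<and> (\<exists>M. good k M)"
      by (intro eventually_conj)
    then obtain k0 where k0: "\<And>k. k \<ge> k0 \<Longrightarrow> 105 * (1 / 4) ^ k < L / 2"
      "\<And>k. k \<ge> k0 \<Longrightarrow> \<exists>M. good k M"
      unfolding eventually_sequentially by blast
    define S where "S = (\<lambda>k. SOME M. good k M)"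
    have goodS: "good k (S k)" if "k \<ge> k0" for k
      unfolding S_def using k0(2)[OF that] by (rule someI_ex)
    have S: "\<And>k. k \<ge> k0 \<Longrightarrow> S k \<subseteq> hexagonal_level k" "\<And>k. k \<ge> k0 \<Longrightarrow> finite (S k)"
       "\<And>k. k \<ge> k0 \<Longrightarrow> S k \<subseteq> {u + L / 2 - 104 / 4 ^ k..u + 3 * L / 2 + 104 / 4 ^ k}"
       "\<And>k x y. k \<ge> k0 \<Longrightarrow> x \<in> S k \<Longrightarrow> y \<in> S k \<Longrightarrow> x \<noteq> y \<Longrightarrow> \<bar>x - y\<bar> \<ge> 1 / 4 ^ k"
       "\<And>k. k \<ge> k0 \<Longrightarrow> (u + 3 * L / 2 - (u + L / 2)) * 4 ^ k / 420 \<le> card (S k)"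
      using goodS unfolding good_def by blast+
    have small: "104 / 4 ^ k + 1 / 4 ^ k < L / 2" if "k \<ge> k0" for k
      using k0(1)[OF that] by (simp add: power_one_over field_simps)
    have inside: "{x - e k / 4 ^ Suc k..x + e k / 4 ^ Suc k} \<subseteq> {u<..<v}" if "k \<ge> k0" "x \<in> S k" for k x
    proof -
      have "e k / 4 ^ Suc k \<le> 1 / 4 ^ k" using e(2)[of k] by (intro frac_le) auto
      moreover have "u + L / 2 - 104 / 4 ^ k \<le> x" "x \<le> u + 3 * L / 2 + 104 / 4 ^ k"
        using S(3)[OF that(1)] that(2) by auto
      ultimately show ?thesis using small[OF that(1)] unfolding v by auto
    qed
    have thick: "L / (6 * 840\<^sup>2) \<le> measure lborel (D m \<inter> {u<..<v})" for m
    proof -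
      define m' where "m' = max m k0"
      obtain n where n: "L / (6 * 840\<^sup>2) \<le>
          measure lborel (\<Union>k\<in>{m'..<n}. \<Union>x\<in>S k. {x - e k / 4 ^ Suc k..x + e k / 4 ^ Suc k})"
      proof (rule separated_balls_union_thick[where S = S and m = m' and w = u and L = L and e = e])
        fix k assume "m' \<le> k"
        then have k: "k \<ge> k0" by (simp add: m'_def)
        show "finite (S k)" using S(2)[OF k] .
        show "S k \<subseteq> {u..u + 2 * L}"
        proof
          fix x assume "x \<in> S k"
          then have "{x - e k / 4 ^ Suc k..x + e k / 4 ^ Suc k} \<subseteq> {u<..<v}" using inside k by blast
          then have "x \<in> {u<..<v}" using e(1)[of k] by (auto simp: subset_iff)
          then show "x \<in> {u..u + 2 * L}" by (simp add: v)
        qed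
        show "L * 4 ^ k / 420 \<le> card (S k)" using S(5)[OF k] by (simp add: field_simps)
        have "105 * (1 / 4) ^ k * 4 ^ k < L / 2 * 4 ^ k"
          using k0(1)[OF k] by (intro mult_strict_right_mono) auto
        then show "1 \<le> L * 4 ^ k" by (simp add: power_one_over)
        fix x y assume "x \<in> S k" "y \<in> S k" "x \<noteq> y"
        then show "1 / 4 ^ k \<le> \<bar>x - y\<bar>" using S(4)[OF k] by blast
      qed (use L e in auto)
      also have "measure lborel (\<Union>k\<in>{m'..<n}. \<Union>x\<in>S k. {x - e k / 4 ^ Suc k..x + e k / 4 ^ Suc k})
          \<le> measure lborel (D m \<inter> {u<..<v})"
      proof (rule measure_mono_fmeasurable)
        show "(\<Union>k\<in>{m'..<n}. \<Union>x\<in>S k. {x - e k / 4 ^ Suc k..x + e k / 4 ^ Suc k}) \<subseteq> D m \<inter> {u<..<v}"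
        proof (intro UN_least Int_greatest)
          fix k x assume kx: "k \<in> {m'..<n}" "x \<in> S k"
          then have k: "k \<ge> k0" "k \<ge> m" by (auto simp: m'_def)
          show "{x - e k / 4 ^ Suc k..x + e k / 4 ^ Suc k} \<subseteq> {u<..<v}" using inside k kx by blast
          show "{x - e k / 4 ^ Suc k..x + e k / 4 ^ Suc k} \<subseteq> D m"
            unfolding D_def G_def using subsetD[OF S(1)[OF k(1)] kx(2)] k(2)
            by (intro SUP_upper2[of k] SUP_upper2[of x]) simp_all
        qed
        show "(\<Union>k\<in>{m'..<n}. \<Union>x\<in>S k. {x - e k / 4 ^ Suc k..x + e k / 4 ^ Suc k}) \<in> sets lborel"
          using S(2) by (intro sets.finite_UN) (simp_all add: m'_def)
        show "D m \<inter> {u<..<v} \<in> fmeasurable lborel"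
        proof (rule fmeasurableI2)
          show "{u<..<v} \<in> fmeasurable lborel" using \<open>u < v\<close> by (intro fmeasurableI) simp_all
          show "D m \<inter> {u<..<v} \<in> sets lborel" using D[of m] by (metis borel_open open_greaterThanLessThan sets.Int sets_lborel)
        qed (rule Int_lower2)
      qed
      finally show ?thesis .
    qed
    have fin: "emeasure lborel (X \<inter> {u<..<v}) \<noteq> \<infinity>" for X
    proof -
      have "emeasure lborel (X \<inter> {u<..<v}) \<le> emeasure lborel {u<..<v}" by (intro emeasure_mono) auto
      also have "\<dots> < \<infinity>" using \<open>u < v\<close> by simp
      finally show ?thesis by simp
    qed
    \<comment> \<open>Continuity from above, valid inside a bounded interval, carries the bound from
      the tails to their intersection.\<close>
    have "D n \<subseteq> D m" if "m \<le> n" for m n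
      unfolding D_def using that by (intro UN_mono) auto
    then have "decseq (\<lambda>m. D m \<inter> {u<..<v})"
      unfolding decseq_def by blast
    then have "(\<lambda>m. measure lborel (D m \<inter> {u<..<v})) \<longlonglongrightarrow> measure lborel (\<Inter>m. D m \<inter> {u<..<v})"
      using D fin by (intro Lim_measure_decseq) auto
    then have "L / (6 * 840\<^sup>2) \<le> measure lborel (\<Inter>m. D m \<inter> {u<..<v})"
      by (rule LIMSEQ_le_const) (use thick in auto)
    also have "(\<Inter>m. D m \<inter> {u<..<v}) = {u<..<v} \<inter> (\<Inter>m. D m)" by auto
    finally have *: "L / (6 * 840\<^sup>2) \<le> measure lborel ({u<..<v} \<inter> (\<Inter>m. D m))" .
    have "{u<..<v} \<inter> (\<Inter>m. D m) \<in> sets lborel"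
      using D by (intro sets.Int sets.countable_INT) auto
    then have "measure lborel ({u<..<v} - {u<..<v} \<inter> (\<Inter>m. D m)) =
        measure lborel {u<..<v} - measure lborel ({u<..<v} \<inter> (\<Inter>m. D m))"
      using fin[of UNIV] by (intro measure_Diff) auto
    moreover have "{u<..<v} - {u<..<v} \<inter> (\<Inter>m. D m) = - (\<Inter>m. D m) \<inter> {u<..<v}" by auto
    moreover have "(1 - c) * (v - u) = (v - u) - L / (6 * 840\<^sup>2)" by (simp add: c_def L_def field_simps)
    ultimately show "measure lborel (- (\<Inter>m. D m) \<inter> {u<..<v}) \<le> (1 - c) * (v - u)"
      using * \<open>u < v\<close> by simp
  qed
  ultimately show ?thesis by simp
qed

section \<open>Integral test on the half-line\<close>

text \<open>The classical integral test lives on \<open>{0..}\<close>, so \<open>g\<close> is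
  continued by the constant \<open>g 1\<close> on the unit interval; this is the source of
  \<open>max 1\<close>. For non-negative \<open>g\<close>, monotone convergence identifies
  integrability on the half-line with boundedness of the integrals over
  \<open>{1..real n}\<close>.\<close>

lemma integrable_on_atLeast_1_iff_summable:
  fixes g :: "real \<Rightarrow> real"
  assumes g_cont: "continuous_on {1..} g" and g_nonneg: "\<And>x. x \<ge> 1 \<Longrightarrow> g x \<ge> 0"
    and g_dec: "\<And>x y. 1 \<le> x \<Longrightarrow> x \<le> y \<Longrightarrow> g y \<le> g x"
  shows "g integrable_on {1..} \<longleftrightarrow> summable (\<lambda>n. g (max 1 (real n)))"
proof -
  define h where "h = (\<lambda>x. g (max 1 x))"
  interpret antimono_fun_sum_integral_diff h
  proof
    show "continuous_on {0..} h"
      unfolding h_def by (rule continuous_on_compose2[OF g_cont]) (auto intro!: continuous_intros)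
  qed (auto simp: h_def intro!: g_dec g_nonneg)
  have gint: "g integrable_on {1..b}" for b
    by (intro integrable_continuous_real continuous_on_subset[OF g_cont]) auto
  have hint: "h integrable_on {a..b}" if "0 \<le> a" for a b
    using that by (intro integrable_continuous_real continuous_on_subset[OF cont]) auto
  have split: "integral {0..real n} h = g 1 + integral {1..real n} g" if "n \<ge> 1" for n
  proof -
    have "integral {0..1} h = integral {0..1} (\<lambda>_ :: real. g 1)"
      by (intro integral_cong) (auto simp: h_def max_def)
    moreover have "integral {1..real n} h = integral {1..real n} g"
      by (intro integral_cong) (auto simp: h_def max_def)
    moreover have "integral {0..1} h + integral {1..real n} h = integral {0..real n} h"
      using that hint by (intro Henstock_Kurzweil_Integration.integral_combine) auto
    ultimately show ?thesis by simp
  qed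
  have "g integrable_on {1..} \<longleftrightarrow> convergent (\<lambda>n. integral {0..real n} h)"
  proof
    assume g: "g integrable_on {1..}"
    have "integral {0..real n} h \<le> g 1 + integral {1..} g" for n
    proof -
      have "integral {0..real n} h \<le> integral {0..real (Suc n)} h"
        using hint nonneg by (intro integral_subset_le) auto
      also have "\<dots> = g 1 + integral {1..real (Suc n)} g" by (rule split) simp
      also have "integral {1..real (Suc n)} g \<le> integral {1..} g"
        using g gint g_nonneg by (intro integral_subset_le) auto
      finally show ?thesis by simp
    qed
    moreover have "incseq (\<lambda>n. integral {0..real n} h)"
      using hint nonneg by (intro monoI integral_subset_le) auto
    ultimately show "convergent (\<lambda>n. integral {0..real n} h)"
      using incseq_convergent by (metis convergentI)
  next
    assume "convergent (\<lambda>n. integral {0..real n} h)"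
    then have "Bseq (\<lambda>n. integral {0..real n} h)" by (rule convergent_imp_Bseq)
    then obtain B where B: "\<And>n. \<bar>integral {0..real n} h\<bar> \<le> B" by (auto simp: Bseq_def)
    define F where "F = (\<lambda>k x. if x \<in> {1..real (Suc k)} then g x else 0)"
    have F: "integral {1..} (F k) = integral {1..real (Suc k)} g" for k
      unfolding F_def integral_restrict_Int by (simp add: Int_absorb2)
    have "g integrable_on {1..} \<and> (\<lambda>k. integral {1..} (F k)) \<longlonglongrightarrow> integral {1..} g"
    proof (rule monotone_convergence_increasing)
      show "F k integrable_on {1..}" for k
        unfolding F_def integrable_restrict_Int using gint by (simp add: Int_absorb2)
      show "F k x \<le> F (Suc k) x" if "x \<in> {1..}" for k x
        using that g_nonneg by (auto simp: F_def)
      show "(\<lambda>k. F k x) \<longlonglongrightarrow> g x" if x: "x \<in> {1..}" for x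
      proof (rule tendsto_eventually)
        obtain n where "x \<le> real n" using real_arch_simple by blast
        then have "F k x = g x" if "k \<ge> n" for k using that x by (auto simp: F_def)
        then show "\<forall>\<^sub>F k in sequentially. F k x = g x" unfolding eventually_sequentially by blast
      qed
      have "\<bar>integral {1..} (F k)\<bar> \<le> B + \<bar>g 1\<bar>" for k
        using B[of "Suc k"] split[of "Suc k"] unfolding F by linarith
      then show "bounded (range (\<lambda>k. integral {1..} (F k)))"
        unfolding bounded_iff by auto
    qed
    then show "g integrable_on {1..}" ..
  qed
  with integral_test show ?thesis by (simp add: h_def)
qed

text \<open>Each level \<open>k\<close> whose ball contains \<open>\<alpha>\<close> supplies one
  good time \<open>t\<close> with \<open>(k - 3) * ln 2 \<le> t \<le> k + 1\<close>. The lower bound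
  makes these times unbounded; the upper one gives \<open>f t \<le> f (k + 1)\<close>, so the balls
  are small enough.\<close>

lemma T_set_full_if_not_summable:
  fixes f :: "real \<Rightarrow> real"
  assumes mono: "mono_on {0<..} f" and less_1: "\<And>t. t > 0 \<Longrightarrow> f t < 1"
    and div: "\<not> summable (\<lambda>n. 1 - f (max 1 (real n)))"
  shows "- {\<alpha>. mat_act (u_mat \<alpha>) int_lattice \<in> T_set f} \<in> null_sets lebesgue"
proof -
  \<comment> \<open>The cap at 1 keeps the balls of one level disjoint; rounding time up to
    \<open>Suc k\<close> makes \<open>e k \<le> 1 - f t\<close>.\<close>
  define e where "e = (\<lambda>k. min 1 (1 - f (real (Suc k))))"
  have mono': "f x \<le> f y" if "0 < x" "x \<le> y" for x y using mono that by (auto simp: mono_on_def)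
  have e: "0 \<le> e k" "e k \<le> 1" for k using less_1[of "real (Suc k)"] by (auto simp: e_def)
  have "decseq e" unfolding decseq_def e_def
    by (intro allI impI min.mono diff_left_mono mono') auto
  \<comment> \<open>A summable capped sequence would eventually be below 1 and so agree with the
    uncapped one.\<close>
  moreover have "\<not> summable e"
  proof
    assume "summable e"
    then have "e \<longlonglongrightarrow> 0" by (rule summable_LIMSEQ_zero)
    then have "\<forall>\<^sub>F k in sequentially. e k < 1" by (rule order_tendstoD) simp
    then have "\<forall>\<^sub>F k in sequentially. e k = 1 - f (max 1 (real (Suc k)))"
      by eventually_elim (auto simp: e_def min_def split: if_splits)
    then have "summable (\<lambda>k. 1 - f (max 1 (real (Suc k))))"
      using summable_cong[of e "\<lambda>k. 1 - f (max 1 (real (Suc k)))"] \<open>summable e\<close> by simp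
    then have "summable (\<lambda>n. 1 - f (max 1 (real n)))" by (rule summable_Suc_iff[THEN iffD1])
    with div show False by simp
  qed
  ultimately have null: "- {\<alpha>. \<forall>m. \<exists>k\<ge>m. \<exists>x\<in>hexagonal_level k. \<bar>\<alpha> - x\<bar> \<le> e k / 4 ^ Suc k} \<in> null_sets lborel"
    using e by (intro hexagonal_limsup_complement_null)
  have "mat_act (u_mat \<alpha>) int_lattice \<in> T_set f"
    if \<alpha>: "\<forall>m. \<exists>k\<ge>m. \<exists>x\<in>hexagonal_level k. \<bar>\<alpha> - x\<bar> \<le> e k / 4 ^ Suc k" for \<alpha>
    unfolding lattice_in_T_set_iff
  proof
    assume "bounded {t. t > 0 \<and> (\<forall>p q. (p, q) \<noteq> (0, 0) \<longrightarrow> f t / sqrt Delta \<le> sqrt (lattice_form \<alpha> t p q))}"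
      (is "bounded ?T")
    then obtain B where B: "\<forall>t\<in>?T. \<bar>t\<bar> \<le> B"
      unfolding bounded_iff real_norm_def ..
    \<comment> \<open>The shift by 3 is half of \<open>ln 64 / ln 2\<close>, from
      \<open>4 ^ k \<le> 64 * N\<close>.\<close>
    obtain m where m: "B < (real m - 3) * ln 2"
    proof -
      obtain m where "B / ln 2 + 3 < real m" using reals_Archimedean2 by blast
      then show thesis by (intro that[of m]) (simp add: field_simps)
    qed
    obtain k x where k: "k \<ge> m" and x: "x \<in> hexagonal_level k" "\<bar>\<alpha> - x\<bar> \<le> e k / 4 ^ Suc k"
      using \<alpha> by blast
    obtain N b c :: int where N: "x = b / (2 * N)" "4 * N * c = b\<^sup>2 + 3" "4 ^ k \<le> 64 * N" "N \<le> 3 * 4 ^ k"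
      using x(1) unfolding hexagonal_level_def by auto
    have "real_of_int (4 ^ k) \<le> real_of_int (64 * N)" "real_of_int N \<le> real_of_int (3 * 4 ^ k)"
      using N by (simp_all only: of_int_le_iff)
    then have Nr: "4 ^ k \<le> 64 * real_of_int N" "real_of_int N \<le> 3 * 4 ^ k" by simp_all
    have N0: "N > 0" using N(3) zero_less_power[of "4 :: int" k] by linarith
    then have N1: "real_of_int N \<ge> 1" by simp
    have "3 / 2 < sqrt 3" by (rule real_less_rsqrt) (simp add: power2_eq_square)
    moreover have "sqrt 3 < 2" by (rule real_less_lsqrt) auto
    ultimately have sq: "3 / 2 < sqrt 3" "sqrt 3 < 2" .
    define t where "t = ln (2 * N / sqrt 3) / 2"
    have Nle: "real_of_int N \<le> 2 * N / sqrt 3" using sq N0 by (simp add: field_simps)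
    have "1 < 2 * N / sqrt 3" using sq N1 by (simp add: field_simps)
    then have "ln (2 * N / sqrt 3) > 0" by (rule ln_gt_zero)
    then have t0: "t > 0" unfolding t_def by (rule half_gt_zero)
    \<comment> \<open>\<open>2 * N / sqrt 3\<close> is at most \<open>4 ^ Suc k\<close>, and 4 is
      below the square of \<open>exp 1\<close>.\<close>
    have tk: "t \<le> real (Suc k)"
    proof -
      have "2 * N / sqrt 3 \<le> 2 * (3 * 4 ^ k) / sqrt 3"
        using Nr by (intro divide_right_mono) auto
      also have "\<dots> = 2 * sqrt 3 * 4 ^ k" by (simp add: field_simps)
      also have "\<dots> \<le> 4 * 4 ^ k" using sq by simp
      also have "\<dots> = (2 * 2) ^ Suc k" by simp
      also have "\<dots> \<le> (exp 1 * exp 1) ^ Suc k"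
        using exp_ge_add_one_self[of 1] by (intro power_mono mult_mono) auto
      also have "\<dots> = exp (2 * real (Suc k))"
        by (simp only: exp_of_nat_mult[symmetric] exp_add[symmetric]) (simp add: algebra_simps)
      finally have "ln (2 * N / sqrt 3) \<le> ln (exp (2 * real (Suc k)))"
        using N0 by (intro ln_mono) auto
      then show ?thesis by (simp add: t_def)
    qed
    have "f t / sqrt Delta \<le> sqrt (lattice_form \<alpha> t p q)" if "(p, q) \<noteq> (0, 0)" for p q
    proof (rule lattice_form_near_hexagonal[OF N0 N(2) t_def _ less_1[OF t0] that])
      have "\<bar>\<alpha> - b / (2 * N)\<bar> \<le> e k / 4 ^ Suc k" using x(2) N(1) by simp
      also have "\<dots> = e k * (1 / (4 * 4 ^ k))" by simp
      also have "\<dots> \<le> (1 - f t) * (sqrt 3 / (2 * N))"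
      proof (rule mult_mono)
        show "e k \<le> 1 - f t" using mono'[OF t0 tk] by (simp add: e_def)
        \<comment> \<open>With \<open>N \<le> 3 * 4 ^ k\<close> and \<open>sqrt 3 > 3 / 2\<close>,
          the height at level \<open>k\<close> is at least \<open>1 / 4 ^ Suc k\<close>, the unit in
          which the radii are measured.\<close>
        have "2 * real_of_int N \<le> sqrt 3 * (4 * 4 ^ k)"
        proof -
          have "3 / 2 * (4 * 4 ^ k) \<le> sqrt 3 * (4 * 4 ^ k)" using sq by (intro mult_right_mono) auto
          then show ?thesis using Nr(2) by linarith
        qed
        then show "1 / (4 * 4 ^ k) \<le> sqrt 3 / real_of_int (2 * N)"
          using N0 by (simp add: field_simps)
      qed (use less_1[OF t0] in auto)
      finally show "\<bar>\<alpha> - b / (2 * N)\<bar> \<le> (1 - f t) * (sqrt 3 / (2 * N))" by simp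
    qed
    then have "t \<in> ?T" using t0 by (intro CollectI conjI allI impI)
    with B have "\<bar>t\<bar> \<le> B" by (rule bspec)
    then have "t \<le> B" by simp
    moreover have "(real m - 3) * ln 2 \<le> t"
    proof -
      have "(real m - 3) * ln 2 \<le> (real k - 3) * ln 2" using k by (intro mult_right_mono) auto
      also have "\<dots> = (ln (4 ^ k) - ln 64) / 2"
      proof -
        have "ln 4 = 2 * ln (2 :: real)" "ln 64 = 6 * ln (2 :: real)"
          using ln_realpow[of 2 2] ln_realpow[of 2 6] by simp_all
        then show ?thesis by (simp add: ln_realpow algebra_simps)
      qed
      also have "\<dots> = ln (4 ^ k / 64) / 2" by (simp add: ln_div)
      also have "\<dots> \<le> ln (2 * N / sqrt 3) / 2"
        using Nr Nle by (intro divide_right_mono ln_mono) auto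
      finally show ?thesis by (simp add: t_def)
    qed
    ultimately show False using m by simp
  qed
  then have "- {\<alpha>. mat_act (u_mat \<alpha>) int_lattice \<in> T_set f} \<subseteq>
      - {\<alpha>. \<forall>m. \<exists>k\<ge>m. \<exists>x\<in>hexagonal_level k. \<bar>\<alpha> - x\<bar> \<le> e k / 4 ^ Suc k}" by auto
  then show ?thesis using null_sets_completionI[OF null] by (rule null_sets_completion_subset)
qed

section \<open>Reduction of nearly hexagonal lattices\<close>

lemma lattice_form_mult: "lattice_form \<alpha> t (k * p) (k * q) = (real_of_int k)\<^sup>2 * lattice_form \<alpha> t p q"
  by (simp add: lattice_form_def power2_eq_square algebra_simps)

lemma lattice_form_pos: "(p, q) \<noteq> (0, 0) \<Longrightarrow> lattice_form \<alpha> t p q > 0"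
  using lattice_form_eq_0_iff[of \<alpha> t p q] by (auto simp: lattice_form_def less_le)

lemma finite_lattice_form_le: "finite {(p, q). lattice_form \<alpha> t p q \<le> R}"
proof (cases "R \<ge> 0")
  case True
  define B where "B = exp t * sqrt R"
  define B' where "B' = sqrt R / exp t + \<bar>\<alpha>\<bar> * B"
  have "{(p, q). lattice_form \<alpha> t p q \<le> R} \<subseteq> {-\<lfloor>B'\<rfloor>..\<lfloor>B'\<rfloor>} \<times> {-\<lfloor>B\<rfloor>..\<lfloor>B\<rfloor>}"
  proof safe
    fix p q :: int assume le: "lattice_form \<alpha> t p q \<le> R"
    have "(exp (- t) * q)\<^sup>2 \<le> R"
      using le zero_le_power2[of "exp t * (p + \<alpha> * q)"] unfolding lattice_form_def by linarith
    then have "\<bar>exp (- t) * q\<bar> \<le> sqrt R" by (simp add: real_le_rsqrt)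
    then have q: "\<bar>real_of_int q\<bar> \<le> B" by (simp add: B_def abs_mult exp_minus field_simps)
    have "(exp t * (p + \<alpha> * q))\<^sup>2 \<le> R"
      using le zero_le_power2[of "exp (- t) * q"] unfolding lattice_form_def by linarith
    then have "\<bar>exp t * (p + \<alpha> * q)\<bar> \<le> sqrt R" by (simp add: real_le_rsqrt)
    then have "\<bar>p + \<alpha> * q\<bar> \<le> sqrt R / exp t" by (simp only: abs_mult abs_exp_cancel pos_le_divide_eq exp_gt_zero mult.commute)
    moreover have "\<bar>\<alpha> * q\<bar> \<le> \<bar>\<alpha>\<bar> * B" using q by (simp add: abs_mult mult_left_mono)
    ultimately have "\<bar>real_of_int p\<bar> \<le> B'" unfolding B'_def by linarith
    then show "p \<in> {-\<lfloor>B'\<rfloor>..\<lfloor>B'\<rfloor>}" by (simp only: atLeastAtMost_iff) linarith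
    show "q \<in> {-\<lfloor>B\<rfloor>..\<lfloor>B\<rfloor>}" using q by (simp only: atLeastAtMost_iff) linarith
  qed
  then show ?thesis by (rule finite_subset) auto
next
  case False
  then have "{(p, q). lattice_form \<alpha> t p q \<le> R} = {}"
    using sum_power2_ge_zero by (auto simp: lattice_form_def not_le intro: less_le_trans)
  then show ?thesis by simp
qed

lemma lattice_form_minimizer:
  assumes "(p\<^sub>0, q\<^sub>0) \<in> P"
  obtains p q where "(p, q) \<in> P" "\<And>p' q'. (p', q') \<in> P \<Longrightarrow> lattice_form \<alpha> t p q \<le> lattice_form \<alpha> t p' q'"
proof -
  let ?F = "\<lambda>(p, q). lattice_form \<alpha> t p q"
  let ?S = "P \<inter> {(p, q). lattice_form \<alpha> t p q \<le> lattice_form \<alpha> t p\<^sub>0 q\<^sub>0}"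
  have "finite ?S" using finite_lattice_form_le by blast
  moreover have "?S \<noteq> {}" using assms by auto
  ultimately obtain v where v: "v \<in> ?S" "\<And>w. w \<in> ?S \<Longrightarrow> ?F v \<le> ?F w"
    using that[of "arg_min_on ?F ?S"] arg_min_if_finite(1)[of ?S ?F] arg_min_least[of ?S _ ?F]
    by presburger
  obtain p q where pq: "v = (p, q)" by fastforce
  show thesis
  proof (rule that[of p q])
    show "(p, q) \<in> P" using v(1) pq by simp
    fix p' q' assume "(p', q') \<in> P"
    then show "lattice_form \<alpha> t p q \<le> lattice_form \<alpha> t p' q'"
      using v(1) v(2)[of "(p', q')"] pq by (cases "(p', q') \<in> ?S") auto
  qed
qed

text \<open>Twice the inner product, that is, the middle coefficient of the form in the given basis,
  so that the discriminant reads \<open>B\<^sup>2 - 4 * A * C\<close>.\<close>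

definition lattice_polar :: "real \<Rightarrow> real \<Rightarrow> int \<Rightarrow> int \<Rightarrow> int \<Rightarrow> int \<Rightarrow> real" where
  "lattice_polar \<alpha> t p q p' q' =
     2 * (exp t * (p + \<alpha> * q)) * (exp t * (p' + \<alpha> * q')) + 2 * (exp (- t) * q) * (exp (- t) * q')"

lemma lattice_form_add:
  "lattice_form \<alpha> t (p + p') (q + q') =
     lattice_form \<alpha> t p q + lattice_polar \<alpha> t p q p' q' + lattice_form \<alpha> t p' q'"
  by (simp add: lattice_form_def lattice_polar_def power2_eq_square algebra_simps)

lemma lattice_form_diff:
  "lattice_form \<alpha> t (p - p') (q - q') =
     lattice_form \<alpha> t p q - lattice_polar \<alpha> t p q p' q' + lattice_form \<alpha> t p' q'"
  by (simp add: lattice_form_def lattice_polar_def power2_eq_square algebra_simps)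

text \<open>Gauss reduction by minimality. A shortest vector is primitive, as division by the gcd
  would shorten it. Take the shortest vector completing it to a basis of determinant 1: adding or
  subtracting the first vector cannot shorten it, which bounds the polar term.\<close>

lemma reduced_lattice_basis:
  obtains p\<^sub>1 q\<^sub>1 p\<^sub>2 q\<^sub>2 :: int where "p\<^sub>1 * q\<^sub>2 - p\<^sub>2 * q\<^sub>1 = 1"
    "0 \<le> lattice_polar \<alpha> t p\<^sub>1 q\<^sub>1 p\<^sub>2 q\<^sub>2"
    "lattice_polar \<alpha> t p\<^sub>1 q\<^sub>1 p\<^sub>2 q\<^sub>2 \<le> lattice_form \<alpha> t p\<^sub>1 q\<^sub>1"
    "lattice_polar \<alpha> t p\<^sub>1 q\<^sub>1 p\<^sub>2 q\<^sub>2 \<le> lattice_form \<alpha> t p\<^sub>2 q\<^sub>2"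
proof -
  obtain p q where pq: "(p, q) \<noteq> (0, 0)"
    and min: "\<And>p' q'. (p', q') \<noteq> (0, 0) \<Longrightarrow> lattice_form \<alpha> t p q \<le> lattice_form \<alpha> t p' q'"
    using lattice_form_minimizer[of 1 0 "- {(0, 0)}" \<alpha> t] by auto
  have "gcd p q = 1"
  proof (rule ccontr)
    assume g: "gcd p q \<noteq> 1"
    obtain p' q' where p': "p = gcd p q * p'" "q = gcd p q * q'"
      by (meson dvdE gcd_dvd1 gcd_dvd2)
    have "gcd p q > 0" using pq by (simp add: less_le)
    with g have "gcd p q \<ge> 2" by linarith
    then have "(2 :: real)\<^sup>2 \<le> (real_of_int (gcd p q))\<^sup>2" by (intro power_mono) auto
    have "(p', q') \<noteq> (0, 0)" using p' pq by auto
    then have "lattice_form \<alpha> t p q \<le> lattice_form \<alpha> t p' q'" "lattice_form \<alpha> t p' q' > 0"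
      by (auto intro: min lattice_form_pos)
    moreover have "lattice_form \<alpha> t p q = (real_of_int (gcd p q))\<^sup>2 * lattice_form \<alpha> t p' q'"
      using p' lattice_form_mult by metis
    moreover have "2\<^sup>2 * lattice_form \<alpha> t p' q' \<le> (real_of_int (gcd p q))\<^sup>2 * lattice_form \<alpha> t p' q'"
      using \<open>2\<^sup>2 \<le> _\<close> \<open>lattice_form \<alpha> t p' q' > 0\<close> by (intro mult_right_mono) auto
    ultimately show False by simp
  qed
  then obtain u v where "u * p + v * q = 1" using bezout_int[of p q] by auto
  then have "(- v, u) \<in> {(p', q'). p * q' - p' * q = 1}" by (simp add: algebra_simps)
  then obtain p' q' where "(p', q') \<in> {(p', q'). p * q' - p' * q = 1}"
    and min': "\<And>r s. (r, s) \<in> {(p', q'). p * q' - p' * q = 1} \<Longrightarrow> lattice_form \<alpha> t p' q' \<le> lattice_form \<alpha> t r s"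
    using lattice_form_minimizer[of "- v" u "{(p', q'). p * q' - p' * q = 1}" \<alpha> t] by auto
  then have det: "p * q' - p' * q = 1" by simp
  have "lattice_form \<alpha> t p' q' \<le> lattice_form \<alpha> t (p' + p) (q' + q)"
    "lattice_form \<alpha> t p' q' \<le> lattice_form \<alpha> t (p' - p) (q' - q)"
    using det by (auto intro!: min' simp: algebra_simps)
  moreover have "lattice_polar \<alpha> t p' q' p q = lattice_polar \<alpha> t p q p' q'"
    by (simp add: lattice_polar_def)
  ultimately have B: "\<bar>lattice_polar \<alpha> t p q p' q'\<bar> \<le> lattice_form \<alpha> t p q"
    unfolding lattice_form_add lattice_form_diff by linarith
  have "(p', q') \<noteq> (0, 0)" using det by auto
  then have AC: "lattice_form \<alpha> t p q \<le> lattice_form \<alpha> t p' q'" by (rule min)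
  show thesis
  proof (cases "lattice_polar \<alpha> t p q p' q' \<ge> 0")
    case True
    then show ?thesis using that[of p q' p' q] det B AC by simp
  next
    \<comment> \<open>Negating the second vector makes the polar term non-negative but reverses the
      orientation, so the two vectors are also swapped. Hence the conclusion is symmetric in them
      and does not say which is shorter.\<close>
    case False
    have "lattice_polar \<alpha> t (- p') (- q') p q = - lattice_polar \<alpha> t p q p' q'"
      "lattice_form \<alpha> t (- p') (- q') = lattice_form \<alpha> t p' q'"
      by (simp_all add: lattice_polar_def lattice_form_def power2_eq_square algebra_simps)
    then show ?thesis using that[of "- p'" q p "- q'"] det B AC False by (simp add: algebra_simps)
  qed
qed

text \<open>Minus the real part of the modular orbit point at which the two vectors span a hexagonal
  lattice, that is, minus the value of \<open>\<alpha>\<close> forced by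
  \<open>A = B = C\<close>.\<close>

definition hexagonal_abscissa :: "int \<Rightarrow> int \<Rightarrow> int \<Rightarrow> int \<Rightarrow> real" where
  "hexagonal_abscissa p\<^sub>1 q\<^sub>1 p\<^sub>2 q\<^sub>2 =
     (2 * p\<^sub>1 * q\<^sub>1 - (p\<^sub>1 * q\<^sub>2 + p\<^sub>2 * q\<^sub>1) + 2 * p\<^sub>2 * q\<^sub>2) / (2 * (q\<^sub>1\<^sup>2 - q\<^sub>1 * q\<^sub>2 + q\<^sub>2\<^sup>2))"

text \<open>Reducedness gives \<open>B\<^sup>2 \<le> A * C\<close>, so the discriminant forces
  \<open>A * C \<le> 1\<close>. As \<open>A\<close> and \<open>C\<close> are at least
  \<open>1 - 2 * \<epsilon>\<close>, neither can exceed \<open>1 + 4 * \<epsilon>\<close>, and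
  \<open>B\<^sup>2 = 4 * A * C - 3\<close> is at least \<open>1 - 16 * \<epsilon>\<close>. The
  constants are 20 = 4 + 16 and 6 = 4 + 2.\<close>

lemma reduced_form_near_hexagonal:
  fixes A B C r :: real
  assumes disc: "4 * A * C - B\<^sup>2 = 3" and red: "0 \<le> B" "B \<le> A" "B \<le> C"
    and min: "r\<^sup>2 \<le> A" "r\<^sup>2 \<le> C" and r: "31 / 32 \<le> r" "r < 1"
  shows "\<bar>A - B\<bar> \<le> 20 * (1 - r)" "\<bar>B - C\<bar> \<le> 20 * (1 - r)" "\<bar>A - C\<bar> \<le> 6 * (1 - r)"
    "B \<le> 1" "3 / 4 \<le> A" "3 / 4 \<le> C"
proof -
  define \<epsilon> where "\<epsilon> = 1 - r"
  have \<epsilon>: "0 < \<epsilon>" "\<epsilon> \<le> 1 / 32" using r by (auto simp: \<epsilon>_def)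
  have "r\<^sup>2 = 1 - 2 * \<epsilon> + \<epsilon> * \<epsilon>" by (simp add: \<epsilon>_def power2_eq_square algebra_simps)
  then have "1 - 2 * \<epsilon> \<le> r\<^sup>2" by simp
  then have A: "1 - 2 * \<epsilon> \<le> A" and C: "1 - 2 * \<epsilon> \<le> C" using min by auto
  have "B * B \<le> A * C" using red by (intro mult_mono) auto
  then have AC: "A * C \<le> 1" using disc by (simp add: power2_eq_square)
  have upper: "x \<le> 1 + 4 * \<epsilon>" if "1 - 2 * \<epsilon> \<le> y" "x * y \<le> 1" "0 < x" for x y
  proof (rule ccontr)
    assume "\<not> x \<le> 1 + 4 * \<epsilon>"
    have "1 \<le> (1 + 4 * \<epsilon>) * (1 - 2 * \<epsilon>)"
    proof -
      have "\<epsilon> * \<epsilon> \<le> \<epsilon> * (1 / 32)" using \<epsilon> by (intro mult_left_mono) auto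
      then show ?thesis using \<epsilon> by (simp add: algebra_simps)
    qed
    also have "\<dots> < x * (1 - 2 * \<epsilon>)" using \<open>\<not> x \<le> 1 + 4 * \<epsilon>\<close> \<epsilon> by (intro mult_strict_right_mono) auto
    also have "\<dots> \<le> x * y" using that by (intro mult_left_mono) auto
    finally show False using that by simp
  qed
  have A': "A \<le> 1 + 4 * \<epsilon>" using upper[of C A] C AC A \<epsilon> by simp
  have C': "C \<le> 1 + 4 * \<epsilon>" using upper[of A C] A AC C \<epsilon> by (simp add: mult.commute)
  have B1: "B \<le> 1"
  proof (rule ccontr)
    assume "\<not> B \<le> 1"
    then have "1 * 1 < B * B" by (intro mult_strict_mono) auto
    with \<open>B * B \<le> A * C\<close> AC show False by simp
  qed
  have B2: "1 - 16 * \<epsilon> \<le> B"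
  proof -
    have "(1 - 2 * \<epsilon>) * (1 - 2 * \<epsilon>) \<le> A * C" using A C \<epsilon> by (intro mult_mono) auto
    moreover have "(1 - 2 * \<epsilon>) * (1 - 2 * \<epsilon>) = 1 - 4 * \<epsilon> + 4 * (\<epsilon> * \<epsilon>)" by (simp add: algebra_simps)
    ultimately have "1 - 4 * \<epsilon> \<le> A * C" using zero_le_square[of \<epsilon>] by linarith
    then have "1 - 16 * \<epsilon> \<le> B * B" using disc by (simp add: power2_eq_square)
    also have "\<dots> \<le> B * 1" using B1 red by (intro mult_left_mono) auto
    finally show ?thesis by simp
  qed
  show "\<bar>A - B\<bar> \<le> 20 * (1 - r)" "\<bar>B - C\<bar> \<le> 20 * (1 - r)" "\<bar>A - C\<bar> \<le> 6 * (1 - r)"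
    using A A' C C' B1 B2 \<epsilon> red unfolding \<epsilon>_def by linarith+
  show "B \<le> 1" "3 / 4 \<le> A" "3 / 4 \<le> C" using B1 A C \<epsilon> by auto
qed

text \<open>In a fixed integral basis \<open>\<alpha>\<close> is a rational function of the
  coefficients \<open>A\<close>, \<open>B\<close>, \<open>C\<close>, and setting all three equal to
  1 turns it into minus the abscissa. Coefficients close to 1 therefore put \<open>\<alpha>\<close>
  close to that value.\<close>

lemma hexagonal_near_if_no_short_vector:
  assumes r: "31 / 32 \<le> r" "r < 1"
    and short: "\<And>p q. (p, q) \<noteq> (0, 0) \<Longrightarrow> r / sqrt Delta \<le> sqrt (lattice_form \<alpha> t p q)"
  obtains p\<^sub>1 q\<^sub>1 p\<^sub>2 q\<^sub>2 :: int where "p\<^sub>1 * q\<^sub>2 - p\<^sub>2 * q\<^sub>1 = 1"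
    "(real_of_int q\<^sub>1)\<^sup>2 + (real_of_int q\<^sub>2)\<^sup>2 \<le> 4 * (exp t)\<^sup>2"
    "\<bar>\<alpha> + hexagonal_abscissa p\<^sub>1 q\<^sub>1 p\<^sub>2 q\<^sub>2\<bar> \<le> 52 * (1 - r) / (exp t)\<^sup>2"
proof -
  obtain p\<^sub>1 q\<^sub>1 p\<^sub>2 q\<^sub>2 :: int where det: "p\<^sub>1 * q\<^sub>2 - p\<^sub>2 * q\<^sub>1 = 1"
    and B: "0 \<le> lattice_polar \<alpha> t p\<^sub>1 q\<^sub>1 p\<^sub>2 q\<^sub>2"
    "lattice_polar \<alpha> t p\<^sub>1 q\<^sub>1 p\<^sub>2 q\<^sub>2 \<le> lattice_form \<alpha> t p\<^sub>1 q\<^sub>1"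
    "lattice_polar \<alpha> t p\<^sub>1 q\<^sub>1 p\<^sub>2 q\<^sub>2 \<le> lattice_form \<alpha> t p\<^sub>2 q\<^sub>2"
    by (rule reduced_lattice_basis)
  define A B C where "A = Delta * lattice_form \<alpha> t p\<^sub>1 q\<^sub>1" and "B = Delta * lattice_polar \<alpha> t p\<^sub>1 q\<^sub>1 p\<^sub>2 q\<^sub>2"
    and "C = Delta * lattice_form \<alpha> t p\<^sub>2 q\<^sub>2"
  define u v x y where "u = real_of_int p\<^sub>1" and "v = real_of_int q\<^sub>1" and "x = real_of_int p\<^sub>2" and "y = real_of_int q\<^sub>2"
  have d: "u * y - x * v = 1"
    unfolding u_def v_def x_def y_def using det by (metis of_int_1 of_int_diff of_int_mult)
  have D: "Delta > 0" "4 * Delta\<^sup>2 = 3" "1 / 2 \<le> Delta" "Delta \<le> 1"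
    by (auto simp: Delta_def power_divide real_le_lsqrt)
  define E where "E = exp t"
  have E: "E > 0" "exp (- t) = 1 / E" by (auto simp: E_def exp_minus field_simps)
  have A_eq: "A = Delta * ((E * (u + \<alpha> * v))\<^sup>2 + (v / E)\<^sup>2)"
    and B_eq: "B = Delta * (2 * (E * (u + \<alpha> * v)) * (E * (x + \<alpha> * y)) + 2 * (v / E) * (y / E))"
    and C_eq: "C = Delta * ((E * (x + \<alpha> * y))\<^sup>2 + (y / E)\<^sup>2)"
    by (simp_all add: A_def B_def C_def lattice_form_def lattice_polar_def E(2) flip: E_def u_def v_def x_def y_def)
  have disc: "4 * A * C - B\<^sup>2 = 3"
  proof -
    have "4 * A * C - B\<^sup>2 = 4 * Delta\<^sup>2 * ((E * (u + \<alpha> * v)) * (y / E) - (v / E) * (E * (x + \<alpha> * y)))\<^sup>2"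
      unfolding A_eq B_eq C_eq by (simp add: power2_eq_square algebra_simps)
    also have "(E * (u + \<alpha> * v)) * (y / E) - (v / E) * (E * (x + \<alpha> * y)) = u * y - x * v"
      using E by (simp add: field_simps)
    finally show ?thesis using d D by simp
  qed
  have ge: "r\<^sup>2 \<le> Delta * lattice_form \<alpha> t p q" if "(p, q) \<noteq> (0, 0)" for p q
  proof -
    have "(r / sqrt Delta)\<^sup>2 \<le> (sqrt (lattice_form \<alpha> t p q))\<^sup>2"
      using short[OF that] r D by (intro power_mono) auto
    then show ?thesis using D lattice_form_pos[OF that, of \<alpha> t]
      by (simp add: power_divide field_simps)
  qed
  have "(p\<^sub>1, q\<^sub>1) \<noteq> (0, 0)" "(p\<^sub>2, q\<^sub>2) \<noteq> (0, 0)" using det by auto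
  then have min: "r\<^sup>2 \<le> A" "r\<^sup>2 \<le> C" unfolding A_def C_def by (auto intro: ge)
  have red: "0 \<le> B" "B \<le> A" "B \<le> C"
    using B D unfolding A_def B_def C_def by (auto intro: mult_left_mono)
  note near = reduced_form_near_hexagonal[OF disc red min r]
  define N where "N = v\<^sup>2 - v * y + y\<^sup>2"
  define b where "b = 2 * u * v - (u * y + x * v) + 2 * x * y"
  define M where "M = Delta * E\<^sup>2"
  have M: "M > 0" using D E by (simp add: M_def)
  \<comment> \<open>Changing back to the standard basis expresses the form's coefficients through
    \<open>A\<close>, \<open>B\<close>, \<open>C\<close>: \<open>M\<close> is the leading one, and
    \<open>\<alpha>M\<close> treats the middle one.\<close>
  have M_eq: "M = A * y\<^sup>2 - B * (v * y) + C * v\<^sup>2"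
  proof -
    have "A * y\<^sup>2 - B * (v * y) + C * v\<^sup>2 = Delta * (E * (u * y - x * v))\<^sup>2"
      unfolding A_eq B_eq C_eq using E by (simp add: power2_eq_square field_simps)
    then show ?thesis by (simp add: d M_def)
  qed
  have \<alpha>M: "2 * \<alpha> * M = - (2 * A * (x * y) - B * (u * y + x * v) + 2 * C * (u * v))"
  proof -
    have "- (2 * A * (x * y) - B * (u * y + x * v) + 2 * C * (u * v)) =
        2 * Delta * E\<^sup>2 * \<alpha> * (u * y - x * v)\<^sup>2"
      unfolding A_eq B_eq C_eq using E by (simp add: power2_eq_square field_simps)
    then show ?thesis by (simp add: d M_def)
  qed
  have vy: "\<bar>2 * (v * y)\<bar> \<le> v\<^sup>2 + y\<^sup>2"
    using zero_le_power2[of "v - y"] zero_le_power2[of "v + y"]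
    by (simp add: power2_eq_square algebra_simps abs_le_iff)
  have N2: "v\<^sup>2 + y\<^sup>2 \<le> 2 * N" using abs_le_D1[OF vy] unfolding N_def by (simp add: algebra_simps)
  have "v\<^sup>2 + y\<^sup>2 > 0" using d by (auto simp: sum_power2_gt_zero_iff)
  then have N0: "N > 0" using N2 by linarith
  \<comment> \<open>The cross-multiplied difference is linear in \<open>A\<close>, \<open>B\<close>,
    \<open>C\<close> and vanishes when they agree; what remains carries the determinant
    \<open>u * y - x * v = 1\<close> as a factor.\<close>
  have ident: "2 * \<alpha> * M * N + b * M = - ((A - B) * y\<^sup>2 + (B - C) * v\<^sup>2 - (A - C) * (2 * (v * y)))"
  proof -
    have "2 * \<alpha> * M * N + b * M = - ((A - B) * y\<^sup>2 + (B - C) * v\<^sup>2 - (A - C) * (2 * (v * y))) * (u * y - x * v)"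
      unfolding \<alpha>M unfolding M_eq N_def b_def by (simp add: power2_eq_square algebra_simps)
    then show ?thesis by (simp only: d mult_1_right)
  qed
  \<comment> \<open>Here 52 = 2 * (20 + 6), doubled by
    \<open>v\<^sup>2 + y\<^sup>2 \<le> 2 * N\<close>.\<close>
  have "\<bar>2 * \<alpha> * M * N + b * M\<bar> \<le> 52 * (1 - r) * N"
  proof -
    have "\<bar>(A - B) * y\<^sup>2\<bar> \<le> 20 * (1 - r) * y\<^sup>2" "\<bar>(B - C) * v\<^sup>2\<bar> \<le> 20 * (1 - r) * v\<^sup>2"
      "\<bar>(A - C) * (2 * (v * y))\<bar> \<le> 6 * (1 - r) * (v\<^sup>2 + y\<^sup>2)"
      using near(1-3) vy r unfolding abs_mult[of "A - B"] abs_mult[of "B - C"] abs_mult[of "A - C"]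
      by (auto intro!: mult_mono)
    then have "\<bar>2 * \<alpha> * M * N + b * M\<bar> \<le> 26 * (1 - r) * (v\<^sup>2 + y\<^sup>2)"
      unfolding ident by (simp add: algebra_simps)
    also have "\<dots> \<le> 26 * (1 - r) * (2 * N)" using N2 r by (intro mult_left_mono) auto
    also have "\<dots> = 52 * (1 - r) * N" by (simp add: algebra_simps)
    finally show ?thesis .
  qed
  moreover have "2 * \<alpha> * M * N + b * M = (\<alpha> + b / (2 * N)) * (2 * M * N)"
    using N0 by (simp add: field_simps)
  ultimately have "\<bar>\<alpha> + b / (2 * N)\<bar> * (2 * M * N) \<le> 52 * (1 - r) * N"
    using N0 M by (simp add: abs_mult)
  then have "(\<bar>\<alpha> + b / (2 * N)\<bar> * (2 * M)) * N \<le> 52 * (1 - r) * N" by (simp add: mult_ac)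
  then have "\<bar>\<alpha> + b / (2 * N)\<bar> * (2 * M) \<le> 52 * (1 - r)" using N0 by (simp only: mult_le_cancel_right_pos)
  moreover have "\<bar>\<alpha> + b / (2 * N)\<bar> * E\<^sup>2 \<le> \<bar>\<alpha> + b / (2 * N)\<bar> * (2 * M)"
  proof (rule mult_left_mono)
    have "1 * E\<^sup>2 \<le> (2 * Delta) * E\<^sup>2" using D by (intro mult_right_mono) auto
    then show "E\<^sup>2 \<le> 2 * M" by (simp add: M_def)
  qed simp
  ultimately have near_b: "\<bar>\<alpha> + b / (2 * N)\<bar> \<le> 52 * (1 - r) / E\<^sup>2"
    using E by (simp add: pos_le_divide_eq)
  \<comment> \<open>The denominators are controlled because the form with coefficients near 1 stays
    definite: 3 / 4 from \<open>A\<close> and \<open>C\<close>, less 1 / 2 from the cross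
    term.\<close>
  have "(v\<^sup>2 + y\<^sup>2) / 4 \<le> M"
  proof -
    have "B * (v * y) \<le> B * ((v\<^sup>2 + y\<^sup>2) / 2)" using red vy by (intro mult_left_mono) auto
    also have "\<dots> \<le> 1 * ((v\<^sup>2 + y\<^sup>2) / 2)" using near(4) by (intro mult_right_mono) auto
    finally have "B * (v * y) \<le> (v\<^sup>2 + y\<^sup>2) / 2" by simp
    moreover have "3 / 4 * y\<^sup>2 \<le> A * y\<^sup>2" "3 / 4 * v\<^sup>2 \<le> C * v\<^sup>2"
      by (rule mult_right_mono[OF near(5)], simp, rule mult_right_mono[OF near(6)], simp)
    ultimately show ?thesis unfolding M_eq by argo
  qed
  also have "M \<le> E\<^sup>2" unfolding M_def using mult_right_mono[OF D(4), of "E\<^sup>2"] by simp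
  finally have "v\<^sup>2 + y\<^sup>2 \<le> 4 * E\<^sup>2" by simp
  moreover have "hexagonal_abscissa p\<^sub>1 q\<^sub>1 p\<^sub>2 q\<^sub>2 = b / (2 * N)"
    by (simp add: hexagonal_abscissa_def b_def N_def u_def v_def x_def y_def)
  ultimately show thesis
    using that[OF det] near_b unfolding v_def y_def E_def by simp
qed

text \<open>The row \<open>(p\<^sub>1, p\<^sub>2)\<close> is determined by
  \<open>(q\<^sub>1, q\<^sub>2)\<close> up to multiples of the latter, and these translate the orbit
  point by integers. Orbit points modulo 1 can thus be counted by pairs of denominators.\<close>

lemma hexagonal_abscissa_cong:
  assumes "p\<^sub>1 * q\<^sub>2 - p\<^sub>2 * q\<^sub>1 = 1" "p\<^sub>1' * q\<^sub>2 - p\<^sub>2' * q\<^sub>1 = 1"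
  obtains m :: int where "hexagonal_abscissa p\<^sub>1' q\<^sub>1 p\<^sub>2' q\<^sub>2 = hexagonal_abscissa p\<^sub>1 q\<^sub>1 p\<^sub>2 q\<^sub>2 + m"
proof
  define m where "m = p\<^sub>1 * (p\<^sub>2' - p\<^sub>2) - p\<^sub>2 * (p\<^sub>1' - p\<^sub>1)"
  have "p\<^sub>1' = p\<^sub>1 + m * q\<^sub>1"
  proof -
    have "m * q\<^sub>1 = p\<^sub>1 * (p\<^sub>2' * q\<^sub>1) - p\<^sub>1 * (p\<^sub>2 * q\<^sub>1) - p\<^sub>1' * (p\<^sub>2 * q\<^sub>1) + p\<^sub>1 * (p\<^sub>2 * q\<^sub>1)"
      by (simp add: m_def algebra_simps)
    moreover have "p\<^sub>2' * q\<^sub>1 = p\<^sub>1' * q\<^sub>2 - 1" "p\<^sub>2 * q\<^sub>1 = p\<^sub>1 * q\<^sub>2 - 1" using assms by auto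
    ultimately show ?thesis by (simp add: algebra_simps)
  qed
  moreover have "p\<^sub>2' = p\<^sub>2 + m * q\<^sub>2"
  proof -
    have "m * q\<^sub>2 = (p\<^sub>1 * q\<^sub>2) * p\<^sub>2' - (p\<^sub>1 * q\<^sub>2) * p\<^sub>2 - p\<^sub>2 * (p\<^sub>1' * q\<^sub>2) + p\<^sub>2 * (p\<^sub>1 * q\<^sub>2)"
      by (simp add: m_def algebra_simps)
    moreover have "p\<^sub>1' * q\<^sub>2 = 1 + p\<^sub>2' * q\<^sub>1" "p\<^sub>1 * q\<^sub>2 = 1 + p\<^sub>2 * q\<^sub>1" using assms by auto
    ultimately show ?thesis by (simp add: algebra_simps)
  qed
  ultimately have p': "p\<^sub>1' = p\<^sub>1 + m * q\<^sub>1" "p\<^sub>2' = p\<^sub>2 + m * q\<^sub>2" .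
  define N where "N = q\<^sub>1\<^sup>2 - q\<^sub>1 * q\<^sub>2 + q\<^sub>2\<^sup>2"
  have "N \<noteq> 0"
  proof
    assume "N = 0"
    moreover have "4 * N = (2 * q\<^sub>1 - q\<^sub>2)\<^sup>2 + 3 * q\<^sub>2\<^sup>2" by (simp add: N_def power2_eq_square algebra_simps)
    ultimately have "(2 * q\<^sub>1 - q\<^sub>2)\<^sup>2 + 3 * q\<^sub>2\<^sup>2 = 0" by simp
    then have "q\<^sub>2 = 0" "q\<^sub>1 = 0"
      by (smt (verit) zero_le_power2 power2_eq_iff_nonneg zero_eq_power2)+
    with assms show False by simp
  qed
  have eq: "2 * p\<^sub>1' * q\<^sub>1 - (p\<^sub>1' * q\<^sub>2 + p\<^sub>2' * q\<^sub>1) + 2 * p\<^sub>2' * q\<^sub>2 =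
      2 * p\<^sub>1 * q\<^sub>1 - (p\<^sub>1 * q\<^sub>2 + p\<^sub>2 * q\<^sub>1) + 2 * p\<^sub>2 * q\<^sub>2 + m * (2 * N)"
    unfolding p' by (simp add: N_def power2_eq_square algebra_simps)
  have abscissa: "hexagonal_abscissa p q\<^sub>1 p' q\<^sub>2 =
      of_int (2 * p * q\<^sub>1 - (p * q\<^sub>2 + p' * q\<^sub>1) + 2 * p' * q\<^sub>2) / of_int (2 * N)" for p p'
    by (simp add: hexagonal_abscissa_def N_def)
  have "hexagonal_abscissa p\<^sub>1' q\<^sub>1 p\<^sub>2' q\<^sub>2 =
      hexagonal_abscissa p\<^sub>1 q\<^sub>1 p\<^sub>2 q\<^sub>2 + of_int (m * (2 * N)) / of_int (2 * N)"
    by (subst abscissa, subst abscissa, subst eq, subst of_int_add, rule add_divide_distrib)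
  also have "of_int (m * (2 * N)) / of_int (2 * N) = real_of_int m" using \<open>N \<noteq> 0\<close> by simp
  finally show "hexagonal_abscissa p\<^sub>1' q\<^sub>1 p\<^sub>2' q\<^sub>2 = hexagonal_abscissa p\<^sub>1 q\<^sub>1 p\<^sub>2 q\<^sub>2 + m" .
qed

section \<open>The convergence case\<close>

text \<open>For times in \<open>[n, n + 1)\<close> there are \<open>O(exp (2 * n))\<close> pairs of
  denominators, each giving one point modulo 1 with an interval of radius
  \<open>O(e n / exp (2 * n))\<close>. In a bounded window the total length is
  \<open>O(e n)\<close>.\<close>

lemma T_set_null_if_summable:
  fixes f :: "real \<Rightarrow> real"
  assumes mono: "mono_on {0<..} f" and less_1: "\<And>t. t > 0 \<Longrightarrow> f t < 1"
    and conv: "summable (\<lambda>n. 1 - f (max 1 (real n)))"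
  shows "{\<alpha>. mat_act (u_mat \<alpha>) int_lattice \<in> T_set f} \<in> null_sets lebesgue"
proof -
  define e where "e = (\<lambda>n. 1 - f (max 1 (real n)))"
  have e0: "e n \<ge> 0" for n
  proof -
    have "f (max 1 (real n)) < 1" by (rule less_1) linarith
    then show ?thesis by (simp add: e_def)
  qed
  have sum_e: "summable e" using conv unfolding e_def .
  have mono': "f x \<le> f y" if "0 < x" "x \<le> y" for x y using mono that by (auto simp: mono_on_def)
  \<comment> \<open>A representative in \<open>[0, 1)\<close> of the abscissa modulo 1. For pairs
    that are not coprime the choice is arbitrary, which merely adds intervals to the cover.\<close>
  define \<xi> where "\<xi> = (\<lambda>(q\<^sub>1, q\<^sub>2). case (SOME (p\<^sub>1, p\<^sub>2). p\<^sub>1 * q\<^sub>2 - p\<^sub>2 * q\<^sub>1 = 1) of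
     (p\<^sub>1, p\<^sub>2) \<Rightarrow> frac (hexagonal_abscissa p\<^sub>1 q\<^sub>1 p\<^sub>2 q\<^sub>2))"
  have \<xi>: "\<exists>m :: int. hexagonal_abscissa p\<^sub>1 q\<^sub>1 p\<^sub>2 q\<^sub>2 = \<xi> (q\<^sub>1, q\<^sub>2) + m"
    if det: "p\<^sub>1 * q\<^sub>2 - p\<^sub>2 * q\<^sub>1 = 1" for p\<^sub>1 q\<^sub>1 p\<^sub>2 q\<^sub>2
  proof -
    obtain r s where rs: "(SOME (p\<^sub>1, p\<^sub>2). p\<^sub>1 * q\<^sub>2 - p\<^sub>2 * q\<^sub>1 = 1) = (r, s)" by fastforce
    have "(\<lambda>(p\<^sub>1, p\<^sub>2). p\<^sub>1 * q\<^sub>2 - p\<^sub>2 * q\<^sub>1 = 1) (r, s)"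
      unfolding rs[symmetric] by (rule someI[of _ "(p\<^sub>1, p\<^sub>2)"]) (simp add: det)
    then have "r * q\<^sub>2 - s * q\<^sub>1 = 1" by simp
    then obtain m :: int where "hexagonal_abscissa p\<^sub>1 q\<^sub>1 p\<^sub>2 q\<^sub>2 = hexagonal_abscissa r q\<^sub>1 s q\<^sub>2 + m"
      using det by (rule hexagonal_abscissa_cong)
    then have "hexagonal_abscissa p\<^sub>1 q\<^sub>1 p\<^sub>2 q\<^sub>2 = \<xi> (q\<^sub>1, q\<^sub>2) + of_int (\<lfloor>hexagonal_abscissa r q\<^sub>1 s q\<^sub>2\<rfloor> + m)"
      by (simp add: \<xi>_def rs frac_def)
    then show ?thesis by blast
  qed
  have \<xi>01: "0 \<le> \<xi> q" "\<xi> q < 1" for q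
    by (auto simp: \<xi>_def frac_lt_1 split: prod.splits)
  define Q where "Q = (\<lambda>n :: nat. {-\<lfloor>2 * exp (real n + 1)\<rfloor>..\<lfloor>2 * exp (real n + 1)\<rfloor>})"
  define \<rho> where "\<rho> = (\<lambda>n. 52 * e n / (exp (real n))\<^sup>2)"
  define G where "G = (\<lambda>R n. \<Union>(q, m)\<in>(Q n \<times> Q n) \<times> {-int R..int R}.
     {(of_int m - \<xi> q) - \<rho> n..(of_int m - \<xi> q) + \<rho> n})"
  have \<rho>0: "\<rho> n \<ge> 0" for n using e0 by (simp add: \<rho>_def)
  have null: "limsup (G R) \<in> null_sets lborel" for R
  proof (rule borel_cantelli_limsup1)
    have G: "G R n \<in> fmeasurable lborel" for n
      unfolding G_def case_prod_unfold by (rule fmeasurable_finite_UN_intervals) (simp add: Q_def)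
    then show "G R n \<in> sets lborel" "emeasure lborel (G R n) < \<infinity>" for n
      by (auto simp: fmeasurable_def)
    \<comment> \<open>The factors count pairs, \<open>(5 * exp (n + 1))\<^sup>2\<close>, then
      translates, \<open>2 * R + 1\<close>, and give the length of an interval, with 104 = 2 *
      52.\<close>
    define K where "K = 25 * (exp 1)\<^sup>2 * (2 * real R + 1) * 104"
    have "norm (measure lborel (G R n)) \<le> K * e n" for n
    proof -
      have "real (card (Q n)) \<le> 5 * exp (real n + 1)"
      proof -
        have "1 \<le> exp (real n + 1)" by simp
        moreover have "real (card (Q n)) \<le> 4 * exp (real n + 1) + 1"
        proof -
          have "0 \<le> \<lfloor>2 * exp (real n + 1)\<rfloor>" by simp
          then have "real (card (Q n)) = 2 * of_int \<lfloor>2 * exp (real n + 1)\<rfloor> + 1" by (simp add: Q_def)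
          then show ?thesis by linarith
        qed
        ultimately show ?thesis by linarith
      qed
      then have "real (card (Q n)) * real (card (Q n)) \<le> (5 * exp (real n + 1)) * (5 * exp (real n + 1))"
        by (intro mult_mono) auto
      then have cQ: "real (card (Q n)) * real (card (Q n)) \<le> 25 * (exp 1)\<^sup>2 * (exp (real n))\<^sup>2"
        by (simp add: exp_add power2_eq_square mult_ac)
      have "measure lborel (G R n) \<le> card ((Q n \<times> Q n) \<times> {-int R..int R}) * (2 * \<rho> n)"
        unfolding G_def case_prod_unfold
      proof (rule measure_finite_UN_intervals_le)
        show "finite ((Q n \<times> Q n) \<times> {-int R..int R})" unfolding Q_def by blast
      qed (rule \<rho>0)
      also have "\<dots> = real (card (Q n)) * real (card (Q n)) * ((2 * real R + 1) * (2 * \<rho> n))"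
        by (simp only: card_cartesian_product of_nat_mult mult.assoc) simp
      also have "\<dots> \<le> 25 * (exp 1)\<^sup>2 * (exp (real n))\<^sup>2 * ((2 * real R + 1) * (2 * \<rho> n))"
        using cQ \<rho>0[of n] by (intro mult_right_mono) auto
      also have "\<dots> = K * e n" by (simp add: K_def \<rho>_def)
      finally show ?thesis by simp
    qed
    then show "summable (\<lambda>n. measure lborel (G R n))"
      by (rule summable_comparison_test'[OF summable_mult[OF sum_e]])
  qed
  have "e \<longlonglongrightarrow> 0" using sum_e by (rule summable_LIMSEQ_zero)
  then have "\<forall>\<^sub>F n in sequentially. e n < 1 / 32" by (rule order_tendstoD) simp
  then obtain n0 where n0: "\<And>n. n \<ge> n0 \<Longrightarrow> e n < 1 / 32" unfolding eventually_sequentially by blast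
  have "\<alpha> \<in> limsup (G (nat \<lceil>\<bar>\<alpha>\<bar>\<rceil> + 4))"
    if "mat_act (u_mat \<alpha>) int_lattice \<in> T_set f" for \<alpha>
  proof -
    \<comment> \<open>The translate is at most \<open>\<bar>\<alpha>\<bar> + 1 + 2\<close> in
      absolute value: 1 for \<open>\<xi>\<close> and 2 for the radius
      \<open>\<rho> n\<close>.\<close>
    define R where "R = nat \<lceil>\<bar>\<alpha>\<bar>\<rceil> + 4"
    have R: "\<bar>\<alpha>\<bar> + 4 \<le> real R" unfolding R_def by linarith
    have "\<exists>n\<ge>k. \<alpha> \<in> G R n" for k
    proof -
      \<comment> \<open>Beyond \<open>n0\<close> the deficit is below 1 / 32, as the reduction
        requires; \<open>n \<ge> 1\<close> makes \<open>max 1 (real n)\<close> equal to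
        \<open>real n\<close>.\<close>
      define k' where "k' = max (max k n0) 1"
      define T where "T = {t. t > 0 \<and> (\<forall>p q. (p, q) \<noteq> (0, 0) \<longrightarrow> f t / sqrt Delta \<le> sqrt (lattice_form \<alpha> t p q))}"
      have "\<not> bounded T" using that unfolding lattice_in_T_set_iff T_def .
      then have "\<not> (\<forall>t\<in>T. norm t \<le> real k')" unfolding bounded_iff by blast
      then obtain t where t: "t \<in> T" "\<bar>t\<bar> > real k'" by (auto simp: not_le)
      then have short: "t > 0" "\<And>p q. (p, q) \<noteq> (0, 0) \<Longrightarrow> f t / sqrt Delta \<le> sqrt (lattice_form \<alpha> t p q)"
        by (auto simp: T_def)
      define n where "n = nat \<lfloor>t\<rfloor>"
      have n: "real n \<le> t" "t < real n + 1" using short(1) unfolding n_def by linarith+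
      have nk: "n \<ge> k'" using t(2) short(1) n by linarith
      then have n1: "n \<ge> 1" "n \<ge> n0" "n \<ge> k" by (auto simp: k'_def)
      \<comment> \<open>Time is rounded down here, so monotonicity bounds the deficit from above,
        opposite to the divergence case.\<close>
      have ef: "1 - f t \<le> e n" using mono'[of "real n" t] n n1 by (simp add: e_def max_def)
      with n0[OF n1(2)] have "31 / 32 \<le> f t" by linarith
      then obtain p\<^sub>1 q\<^sub>1 p\<^sub>2 q\<^sub>2 :: int where det: "p\<^sub>1 * q\<^sub>2 - p\<^sub>2 * q\<^sub>1 = 1"
        and q: "(real_of_int q\<^sub>1)\<^sup>2 + (real_of_int q\<^sub>2)\<^sup>2 \<le> 4 * (exp t)\<^sup>2"
        and near: "\<bar>\<alpha> + hexagonal_abscissa p\<^sub>1 q\<^sub>1 p\<^sub>2 q\<^sub>2\<bar> \<le> 52 * (1 - f t) / (exp t)\<^sup>2"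
        using less_1[OF short(1)] short(2) by (rule hexagonal_near_if_no_short_vector)
      obtain m :: int where m: "hexagonal_abscissa p\<^sub>1 q\<^sub>1 p\<^sub>2 q\<^sub>2 = \<xi> (q\<^sub>1, q\<^sub>2) + m"
        using \<xi>[OF det] ..
      have "52 * (1 - f t) / (exp t)\<^sup>2 \<le> \<rho> n"
        unfolding \<rho>_def using ef e0 n by (intro frac_le mult_left_mono power_mono) auto
      with near m have a: "\<bar>\<alpha> - (of_int (- m) - \<xi> (q\<^sub>1, q\<^sub>2))\<bar> \<le> \<rho> n" by simp
      have inQ: "z \<in> Q n" if "(real_of_int z)\<^sup>2 \<le> 4 * (exp t)\<^sup>2" for z
      proof -
        have "(real_of_int z)\<^sup>2 \<le> (2 * exp t)\<^sup>2" using that by (simp add: power_mult_distrib)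
        then have "\<bar>real_of_int z\<bar> \<le> 2 * exp t" using abs_le_square_iff[of "real_of_int z" "2 * exp t"] by simp
        also have "\<dots> \<le> 2 * exp (real n + 1)" using n by simp
        finally show ?thesis unfolding Q_def atLeastAtMost_iff by linarith
      qed
      have "q\<^sub>1 \<in> Q n" "q\<^sub>2 \<in> Q n"
        using q zero_le_power2[of "real_of_int q\<^sub>1"] zero_le_power2[of "real_of_int q\<^sub>2"]
        by (intro inQ; linarith)+
      moreover have "- m \<in> {-int R..int R}"
      proof -
        have "\<rho> n \<le> 2"
        proof -
          have "\<rho> n \<le> 52 * e n / 1" unfolding \<rho>_def using e0[of n] by (intro divide_left_mono) auto
          then show ?thesis using n0[OF n1(2)] by linarith
        qed
        then have "\<bar>real_of_int (- m)\<bar> \<le> real R" using a R \<xi>01[of "(q\<^sub>1, q\<^sub>2)"] by linarith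
        then show ?thesis by (simp only: atLeastAtMost_iff) linarith
      qed
      ultimately have "((q\<^sub>1, q\<^sub>2), - m) \<in> (Q n \<times> Q n) \<times> {-int R..int R}" by blast
      moreover have "\<alpha> \<in> (\<lambda>(q, m). {(of_int m - \<xi> q) - \<rho> n..(of_int m - \<xi> q) + \<rho> n}) ((q\<^sub>1, q\<^sub>2), - m)"
        using a by (simp add: abs_diff_le_iff)
      ultimately have "\<alpha> \<in> G R n" unfolding G_def by (rule UN_I)
      with n1 show ?thesis by blast
    qed
    then show ?thesis unfolding R_def[symmetric] limsup_INF_SUP by blast
  qed
  then have "{\<alpha>. mat_act (u_mat \<alpha>) int_lattice \<in> T_set f} \<subseteq> (\<Union>R. limsup (G R))" by blast
  moreover have "(\<Union>R. limsup (G R)) \<in> null_sets lborel" by (intro null_sets_UN null)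
  ultimately show ?thesis using null_sets_completionI null_sets_completion_subset by blast
qed

text \<open>Integrating from 1 sets aside times near 0, where \<open>f\<close> may be unbounded
  below; \<open>T_set\<close> depends on large times alone. Full measure is expressed as a null
  complement.\<close>

theorem theorem6p3:
  fixes f :: "real \<Rightarrow> real"
  assumes "continuous_on {0<..} f"
    and "mono_on {0<..} f"
    and "\<And>t. t > 0 \<Longrightarrow> f t < 1"
  shows "(\<not> (\<lambda>t. 1 - f t) integrable_on {1..} \<longrightarrow>
            - {\<alpha>. mat_act (u_mat \<alpha>) int_lattice \<in> T_set f} \<in> null_sets lebesgue) \<and>
         ((\<lambda>t. 1 - f t) integrable_on {1..} \<longrightarrow>
            {\<alpha>. mat_act (u_mat \<alpha>) int_lattice \<in> T_set f} \<in> null_sets lebesgue)"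
proof -
  have "(\<lambda>t. 1 - f t) integrable_on {1..} \<longleftrightarrow> summable (\<lambda>n. 1 - f (max 1 (real n)))"
  proof (rule integrable_on_atLeast_1_iff_summable)
    show "continuous_on {1..} (\<lambda>t. 1 - f t)"
      by (intro continuous_intros continuous_on_subset[OF assms(1)]) auto
    show "1 - f t \<ge> 0" if "t \<ge> 1" for t using assms(3)[of t] that by simp
    show "1 - f y \<le> 1 - f x" if "1 \<le> x" "x \<le> y" for x y
      using mono_onD[OF assms(2), of x y] that by simp
  qed
  then show ?thesis
    using T_set_full_if_not_summable[OF assms(2,3)] T_set_null_if_summable[OF assms(2,3)] by simp
qed

end
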